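(* Let $d\ge2$ and let $\mu_1,\dots,\mu_r>-1$ be such that $\mu_i-\mu_j\notin\mathbb Z$ if $i\neq j$. Let $\vec n=(n_1,\dots,n_r),\ \vec j=(j_1,\dots,j_r)\in\mathbb N_0^r$ be such that $0\le|\vec j|\le|\vec n|/2$, and put $M=|\vec n|-2|\vec j|$. Let $\mathbf a=(a_1,\dots,a_d),\ \mathbf m=(m_1,\dots,m_d)\in\mathbb N_0^d$ be such that $|\mathbf m|=M$ and $m_d\in\{0,1\}$, and write $\mathbf x^{\mathbf a}=x_1^{a_1}\cdots x_d^{a_d}$. Then, for $l=1,\dots,r$, $$\int_{B^d}\mathbf P^{\vec n}_{\vec j,\mathbf m}(\mathbf x)\,\mathbf x^{\mathbf a}\,W_l(\mathbf x)\,d\mathbf x=0\qquad\text{if }0\le|\mathbf a|<M+2j_l .$$ Moreover, for $l=1,\dots,r$, this integral also vanishes if, for some $k\in\{1,\dots,d-1\}$, either $a_{d-k}+\cdots+a_d<m_{d-k}+\cdots+m_d$, or $a_{d-k}+\cdots+a_d-(m_{d-k}+\cdots+m_d)$ is an odd positive integer.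
   Context: For a vector $v$ of nonnegative integers, $|v|$ is the sum of its components. $B^d=\{\mathbf x\in\mathbb R^d:\|\mathbf x\|\le1\}$ is the unit ball. Write $\vec\mu=(\mu_1,\dots,\mu_r)$, and $W_l(\mathbf x)=w_{\mu_l}(1-\|\mathbf x\|^2)^{\mu_l}$ with $w_\mu=\Gamma(\mu+1+\tfrac d2)/(\pi^{d/2}\Gamma(\mu+1))$. Spherical polar coordinates $\mathbf x\equiv(\rho,\theta_1,\dots,\theta_{d-1})$: $x_1=\rho\cos\theta_{d-1}$, $x_2=\rho\sin\theta_{d-1}\cos\theta_{d-2}$, …, $x_{d-1}=\rho\sin\theta_{d-1}\cdots\sin\theta_2\cos\theta_1$, $x_d=\rho\sin\theta_{d-1}\cdots\sin\theta_2\sin\theta_1$, with $0\le\rho\le1$, $0\le\theta_1<2\pi$, $0\le\theta_k\le\pi$ for $k=2,\dots,d-1$. Spherical harmonics: for $\mathbf m\in\mathbb N_0^d$ with $|\mathbf m|=M$, $m_d\in\{0,1\}$, $$Y^M_{\mathbf m}(\rho,\theta_1,\dots,\theta_{d-1})=\rho^M g(\theta_1)\prod_{k=1}^{d-2}\Big[(\sin\theta_{d-k})^{\beta_k}C^{\lambda_k}_{m_k}(\cos\theta_{d-k})\Big],$$ where $g(\theta_1)=\cos((m_{d-1}+m_d)\theta_1)$ if $m_d=0$, $g(\theta_1)=\sin((m_{d-1}+m_d)\theta_1)$ if $m_d=1$, $\beta_k=\sum_{i=k+1}^dm_i$, $\lambda_k=\beta_k+(d-k-1)/2$, and $C^{\lambda}_m$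 is the Gegenbauer polynomial of degree $m$, orthogonal on $[-1,1]$ for the weight $(1-t^2)^{\lambda-1/2}$. Type II Jacobi–Piñeiro polynomials: for $\alpha>-1$ and $\vec\gamma=(\gamma_1,\dots,\gamma_r)$ with $\gamma_l>-1$ and $\gamma_i-\gamma_j\notin\mathbb Z$ for $i\ne j$, let $\omega_l(t)=t^\alpha(1-t)^{\gamma_l}$ on $[0,1]$. For $\vec k\in\mathbb N_0^r$, $P^{(\alpha,\vec\gamma)}_{\vec k}$ is the polynomial of degree $|\vec k|$ (unique up to a nonzero constant factor) with $$\int_0^1P^{(\alpha,\vec\gamma)}_{\vec k}(t)\,t^s\,t^\alpha(1-t)^{\gamma_l}\,dt=0,\qquad 0\le s\le k_l-1,\ 1\le l\le r,$$ normalized by the Rodrigues formula $$P^{(\alpha,\vec\gamma)}_{\vec k}(t)=\Big(\tfrac1{\omega_r(t)}\tfrac{d^{k_r}}{dt^{k_r}}\omega_r(t)(1-t)^{k_r}\Big)\cdots\Big(\tfrac1{\omega_1(t)}\tfrac{d^{k_1}}{dt^{k_1}}\omega_1(t)(1-t)^{k_1}\Big)t^{|\vec k|}$$ (composition of operators). Type II multiple orthogonal polynomials on the ball: with $M=|\vec n|-2|\vec j|$, $$\mathbf P^{\vec n}_{\vec j,\mathbf m}(\mathbf x)=P^{(M+(d-2)/2,\vec\mu)}_{\vec j}(\rho^2)\,Y^M_{\mathbf m}(\rho,\theta_1,\dots,\theta_{d-1}),$$ which is a polynomial in $(x_1,\dots,x_d)$ of degree $|\vec n|$. *)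

theory Defs
  imports "HOL-Analysis.Analysis" "HOL-Computational_Algebra.Polynomial"
begin

text \<open>
  Vectors are functions on \<^typ>\<open>nat\<close>: points of \<open>\<real>\<^sup>d\<close> are the extensional functions on
  \<open>{1..d}\<close>, with Lebesgue measure as a product measure, and multi-indices are used only on
  \<open>{1..d}\<close> or \<open>{1..r}\<close>.
\<close>

abbreviation lborel_dim :: "nat \<Rightarrow> (nat \<Rightarrow> real) measure" where
  "lborel_dim d \<equiv> PiM {1..d} (\<lambda>_. lborel)"

definition unit_ball :: "nat \<Rightarrow> (nat \<Rightarrow> real) set" where
  "unit_ball d = {x \<in> {1..d} \<rightarrow>\<^sub>E UNIV. L2_set x {1..d} \<le> 1}"

definition ball_weight :: "nat \<Rightarrow> real \<Rightarrow> (nat \<Rightarrow> real) \<Rightarrow> real" where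
  "ball_weight d \<mu> x =
     Gamma (\<mu> + 1 + real d / 2) / (pi powr (real d / 2) * Gamma (\<mu> + 1))
       * (1 - (L2_set x {1..d})\<^sup>2) powr \<mu>"


text \<open>
  The Gegenbauer polynomial \<open>C\<^sub>m\<close> with parameter \<open>lam > 0\<close>. Degree and orthogonality determine it up
  to a constant factor; the factor is fixed by the usual value \<open>(2 lam)\<^sub>m / m!\<close> at \<open>1\<close>.
\<close>

definition gegenbauer :: "real \<Rightarrow> nat \<Rightarrow> real poly" where
  "gegenbauer lam m = (THE p.
     degree p = m \<and>
     (\<forall>s<m. (LBINT t:{-1..1}. poly p t * t ^ s * (1 - t\<^sup>2) powr (lam - 1/2)) = 0) \<and>
     poly p 1 = pochhammer (2 * lam) m / fact m)"


definition jp_weight :: "real \<Rightarrow> real \<Rightarrow> real \<Rightarrow> real" where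
  "jp_weight \<alpha> g t = t powr \<alpha> * (1 - t) powr g"

definition type_II_jp :: "real \<Rightarrow> nat \<Rightarrow> (nat \<Rightarrow> real) \<Rightarrow> (nat \<Rightarrow> nat) \<Rightarrow> real poly \<Rightarrow> bool" where
  "type_II_jp \<alpha> r \<gamma> k p \<longleftrightarrow>
     degree p = (\<Sum>l=1..r. k l) \<and>
     (\<forall>l\<in>{1..r}. \<forall>s<k l.
        (LBINT t:{0..1}. poly p t * t ^ s * jp_weight \<alpha> (\<gamma> l) t) = 0)"

definition rodrigues_op :: "real \<Rightarrow> real \<Rightarrow> nat \<Rightarrow> (real \<Rightarrow> real) \<Rightarrow> real \<Rightarrow> real" where
  "rodrigues_op \<alpha> g k f t =
     1 / jp_weight \<alpha> g t * (deriv ^^ k) (\<lambda>u. jp_weight \<alpha> g u * (1 - u) ^ k * f u) t"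

text \<open>The operator with index \<open>1\<close> is applied first, the one with index \<open>r\<close> last.\<close>

definition rodrigues :: "real \<Rightarrow> nat \<Rightarrow> (nat \<Rightarrow> real) \<Rightarrow> (nat \<Rightarrow> nat) \<Rightarrow> real \<Rightarrow> real" where
  "rodrigues \<alpha> r \<gamma> k =
     fold (\<lambda>l. rodrigues_op \<alpha> (\<gamma> l) (k l)) [1..<Suc r] (\<lambda>t. t ^ (\<Sum>l=1..r. k l))"

text \<open>
  The Rodrigues formula is imposed on the open interval only: at the end points the weights may
  vanish or be singular.
\<close>

definition jacobi_pineiro :: "real \<Rightarrow> nat \<Rightarrow> (nat \<Rightarrow> real) \<Rightarrow> (nat \<Rightarrow> nat) \<Rightarrow> real poly" where
  "jacobi_pineiro \<alpha> r \<gamma> k = (THE p.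
     type_II_jp \<alpha> r \<gamma> k p \<and> (\<forall>t\<in>{0<..<1}. poly p t = rodrigues \<alpha> r \<gamma> k t))"


definition polar_coords :: "nat \<Rightarrow> (nat \<Rightarrow> real) \<Rightarrow> real \<Rightarrow> (nat \<Rightarrow> real) \<Rightarrow> bool" where
  "polar_coords d x \<rho> \<theta> \<longleftrightarrow>
     0 \<le> \<rho> \<and> 0 \<le> \<theta> 1 \<and> \<theta> 1 < 2 * pi \<and> (\<forall>k\<in>{2..d-1}. 0 \<le> \<theta> k \<and> \<theta> k \<le> pi) \<and>
     (\<forall>i\<in>{1..<d}. x i = \<rho> * (\<Prod>l=1..<i. sin (\<theta> (d - l))) * cos (\<theta> (d - i))) \<and>
     x d = \<rho> * (\<Prod>l=1..<d. sin (\<theta> (d - l)))"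

definition harmonic_beta :: "nat \<Rightarrow> (nat \<Rightarrow> nat) \<Rightarrow> nat \<Rightarrow> nat" where
  "harmonic_beta d m k = (\<Sum>i=k+1..d. m i)"

definition harmonic_lambda :: "nat \<Rightarrow> (nat \<Rightarrow> nat) \<Rightarrow> nat \<Rightarrow> real" where
  "harmonic_lambda d m k = real (harmonic_beta d m k) + (real d - real k - 1) / 2"

definition spherical_harmonic ::
    "nat \<Rightarrow> (nat \<Rightarrow> nat) \<Rightarrow> real \<Rightarrow> (nat \<Rightarrow> real) \<Rightarrow> real" where
  "spherical_harmonic d m \<rho> \<theta> =
     \<rho> ^ (\<Sum>i=1..d. m i)
     * (if m d = 0 then cos (real (m (d - 1) + m d) * \<theta> 1)
        else sin (real (m (d - 1) + m d) * \<theta> 1))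
     * (\<Prod>k=1..d-2. sin (\<theta> (d - k)) ^ harmonic_beta d m k
          * poly (gegenbauer (harmonic_lambda d m k) (m k)) (cos (\<theta> (d - k))))"

text \<open>
  The angles of a point need not be unique (at the origin or where some sine vanishes), but the
  value below does not depend on their choice: the angles that are not determined by the point
  enter only through factors that are constant or are multiplied by zero.
\<close>

definition ball_mop ::
    "nat \<Rightarrow> nat \<Rightarrow> (nat \<Rightarrow> real) \<Rightarrow> (nat \<Rightarrow> nat) \<Rightarrow> (nat \<Rightarrow> nat) \<Rightarrow> (nat \<Rightarrow> nat)
      \<Rightarrow> (nat \<Rightarrow> real) \<Rightarrow> real" where
  "ball_mop d r \<mu> n j m x =
     (let M = (\<Sum>l=1..r. n l) - 2 * (\<Sum>l=1..r. j l) in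
      THE v. \<exists>\<rho> \<theta>. polar_coords d x \<rho> \<theta> \<and>
        v = poly (jacobi_pineiro (real M + (real d - 2) / 2) r \<mu> j) (\<rho>\<^sup>2)
              * spherical_harmonic d m \<rho> \<theta>)"

end

theory Submission
  imports Defs "HOL-Probability.Sinc_Integral"
begin

text \<open>
  Let \<open>R\<^sub>k\<close> be the norm of \<open>(x\<^sub>k, \<dots>, x\<^sub>d)\<close>. As a function of \<open>x\<close>, the spherical harmonic is
  \<open>x\<^sub>d\<close> to the power \<open>m\<^sub>d\<close> times the product over \<open>k < d\<close> of \<open>Q\<^sub>k(x\<^sub>k / R\<^sub>k)\<close> times \<open>R\<^sub>k\<close> to the
  power \<open>m\<^sub>k\<close>, where \<open>Q\<^sub>k\<close> is a Gegenbauer polynomial for \<open>k \<le> d - 2\<close> and a Chebyshev polynomial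
  (the cases \<open>\<lambda> = 0\<close> and \<open>\<lambda> = 1\<close>) for \<open>k = d - 1\<close>. Integrating out \<open>x\<^sub>d, \<dots>, x\<^sub>1\<close> one after the
  other needs polar coordinates only in the half plane of the points \<open>(x\<^sub>k, R\<^bsub>k+1\<^esub>)\<close>. The integral
  of a radial function times the harmonic times a monomial is therefore a radial integral times
  a product of integrals over \<open>[-1, 1]\<close> of \<open>Q\<^sub>k\<close> against a monomial and a power of \<open>1 - t\<^sup>2\<close>, which
  vanish by orthogonality or parity if \<open>a\<^sub>k + \<dots> + a\<^sub>d - (m\<^sub>k + \<dots> + m\<^sub>d)\<close> is negative or odd. In the
  remaining case \<open>|a| = M + 2s\<close> with \<open>s < j\<^sub>l\<close>, the substitution \<open>t = R\<^sup>2\<close> turns the radial integral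
  into the moment of order \<open>s\<close> of the Jacobi-Pineiro polynomial, which is zero.

  The latter follows from the Rodrigues formula: with \<open>\<omega>(t) = t\<^sup>\<alpha> (1 - t)\<^sup>g\<close>, the operator
  \<open>f \<mapsto> \<omega>\<^sup>-\<^sup>1 D\<^sup>k (\<omega> (1 - t)\<^sup>k f)\<close> factors into the first-order operators
  \<open>f \<mapsto> (1 - t) f' + (1 - t) (\<alpha> / t) f - c f\<close> with \<open>c = g + 1, \<dots>, g + k\<close>. These differ by
  multiples of the identity only, so all of them commute, for all \<open>g\<close>, and the operator belonging
  to any given weight may be applied last.
\<close>

section \<open>The Rodrigues formula for Jacobi-Pineiro polynomials\<close>

text \<open>This is \<open>(1 - t) f' + (1 - t) (\<alpha> / t) f - c f\<close> if \<open>f(0) = 0\<close>; otherwise the term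
  \<open>\<alpha> f(0) / t\<close> is dropped, which keeps the operator linear and does not affect commutation.\<close>

definition jp_step :: "real \<Rightarrow> real \<Rightarrow> real poly \<Rightarrow> real poly" where
  "jp_step \<alpha> c f = pderiv f - pCons 0 (pderiv f) + smult \<alpha> (poly_shift 1 f) - smult (\<alpha> + c) f"

lemma coeff_jp_step:
  "coeff (jp_step \<alpha> c f) n
     = (real n + 1 + \<alpha>) * coeff f (Suc n) - (real n + \<alpha> + c) * coeff f n"
  by (cases n)
     (simp_all add: jp_step_def coeff_pderiv coeff_poly_shift coeff_pCons algebra_simps)

lemma jp_step_commute: "jp_step \<alpha> c (jp_step \<alpha> c' f) = jp_step \<alpha> c' (jp_step \<alpha> c f)"
  by (intro poly_eqI) (simp add: coeff_jp_step algebra_simps)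

text \<open>The leading coefficient is multiplied by \<open>-(degree f + \<alpha> + c)\<close>,
  which the sign conditions keep away from zero.\<close>

lemma degree_jp_step:
  assumes "\<alpha> \<ge> 0" "c > 0"
  shows "degree (jp_step \<alpha> c f) = degree f"
proof (cases "f = 0")
  case True
  then show ?thesis by (simp add: jp_step_def poly_shift_0)
next
  case False
  show ?thesis
  proof (rule antisym)
    show "degree (jp_step \<alpha> c f) \<le> degree f"
      by (intro degree_le) (auto simp: coeff_jp_step coeff_eq_0)
    have "coeff (jp_step \<alpha> c f) (degree f) \<noteq> 0"
      using False assms by (simp add: coeff_jp_step coeff_eq_0 add_nonneg_eq_0_iff)
    then show "degree f \<le> degree (jp_step \<alpha> c f)" by (rule le_degree)
  qed
qed

lemma poly_jp_step:
  assumes "coeff f 0 = 0" "t \<noteq> 0"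
  shows "poly (jp_step \<alpha> c f) t
    = (1 - t) * poly (pderiv f) t + (1 - t) * (\<alpha> / t) * poly f t - c * poly f t"
proof -
  have "f = pCons 0 (poly_shift 1 f)"
    using assms(1) by (intro poly_eqI) (simp add: coeff_pCons coeff_poly_shift split: nat.splits)
  then have "poly f t = t * poly (poly_shift 1 f) t"
    by (metis add_0 poly_pCons)
  then show ?thesis
    using assms(2) by (simp add: jp_step_def field_simps)
qed

text \<open>The largest parameter acts first: each differentiation lowers the exponent of the extra
  factor \<open>1 - t\<close> by one and thereby lowers \<open>c\<close> by one for the next
  step.\<close>

fun jp_steps :: "real \<Rightarrow> real \<Rightarrow> nat \<Rightarrow> real poly \<Rightarrow> real poly" where
  "jp_steps \<alpha> g 0 f = f"
| "jp_steps \<alpha> g (Suc k) f = jp_steps \<alpha> g k (jp_step \<alpha> (g + real (Suc k)) f)"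

lemma jp_steps_jp_step:
  "jp_steps \<alpha> g k (jp_step \<alpha> c f) = jp_step \<alpha> c (jp_steps \<alpha> g k f)"
proof (induction k arbitrary: f)
  case (Suc k)
  then show ?case
    using jp_step_commute[of \<alpha> "g + real (Suc k)" c f] by simp
qed simp

lemma jp_steps_commute:
  "jp_steps \<alpha> g k (jp_steps \<alpha> g' k' f) = jp_steps \<alpha> g' k' (jp_steps \<alpha> g k f)"
  by (induction k arbitrary: f) (simp_all add: jp_steps_jp_step)

lemma degree_jp_steps:
  assumes "\<alpha> \<ge> 0" "g > -1"
  shows "degree (jp_steps \<alpha> g k f) = degree f"
  using assms by (induction k arbitrary: f) (simp_all add: degree_jp_step)

text \<open>Coefficient \<open>n\<close> after a step involves only coefficients \<open>n\<close>
  and \<open>n + 1\<close> before it, so a step lowers the order of vanishing at \<open>0\<close> by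
  at most one. This supplies the condition \<open>coeff f 0 = 0\<close> under which
  \<open>jp_step\<close> is the differential operator.\<close>

lemma low_coeffs_jp_steps:
  assumes "\<And>i. i < e + k \<Longrightarrow> coeff f i = 0" "i < e"
  shows "coeff (jp_steps \<alpha> g k f) i = 0"
  using assms by (induction k arbitrary: f) (simp_all add: coeff_jp_step)

section \<open>From the Rodrigues operators to polynomials\<close>

lemma higher_deriv_cong_open:
  assumes "open S" "\<And>t. t \<in> S \<Longrightarrow> f t = g t" "t \<in> S"
  shows "(deriv ^^ k) f t = (deriv ^^ k) g t"
  using assms(2,3)
proof (induction k arbitrary: f g t)
  case (Suc k)
  have *: "deriv f t = deriv g t" if "t \<in> S" for t
    by (rule deriv_cong_ev[OF eventually_mono[OF eventually_nhds_in_open[OF assms(1) that]]])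
       (use Suc.prems(1) in auto)
  show ?case
    unfolding funpow_Suc_right o_def by (rule Suc.IH[OF * Suc.prems(2)])
qed simp

text \<open>Product rule: one factor of \<open>(1 - u) ^ Suc k\<close> cancels the pole that arises
  from differentiating \<open>(1 - u) powr g\<close>, and the two constants \<open>g\<close> and
  \<open>Suc k\<close> combine into the parameter of the step.\<close>

lemma deriv_jp_weight:
  assumes "coeff f 0 = 0" "0 < t" "t < 1"
  shows "deriv (\<lambda>u. jp_weight \<alpha> g u * (1 - u) ^ Suc k * poly f u) t
    = jp_weight \<alpha> g t * (1 - t) ^ k * poly (jp_step \<alpha> (g + real (Suc k)) f) t"
proof (rule DERIV_imp_deriv)
  define A where "A = t powr \<alpha>"
  define G where "G = (1 - t) powr g"
  define K where "K = (1 - t) ^ k"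
  have 1: "((\<lambda>u. u powr \<alpha>) has_field_derivative \<alpha> / t * A) (at t)"
    using assms by (auto intro!: derivative_eq_intros simp: A_def powr_diff)
  have 2: "((\<lambda>u. (1 - u) powr g) has_field_derivative - g / (1 - t) * G) (at t)"
    using assms by (auto intro!: derivative_eq_intros simp: G_def powr_diff)
  have 3: "((\<lambda>u. (1 - u) ^ Suc k) has_field_derivative - real (Suc k) * K) (at t)"
    unfolding K_def by (rule derivative_eq_intros refl | simp add: algebra_simps)+
  have "((\<lambda>u. u powr \<alpha> * (1 - u) powr g * (1 - u) ^ Suc k * poly f u) has_field_derivative
      (((\<alpha> / t * A * G + - g / (1 - t) * G * A) * ((1 - t) * K)
        + - real (Suc k) * K * (A * G)) * poly f t + poly (pderiv f) t * (A * G * ((1 - t) * K))))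
      (at t)"
    using DERIV_mult[OF DERIV_mult[OF DERIV_mult[OF 1 2] 3] poly_DERIV[of f t]]
    by (simp add: A_def G_def K_def)
  moreover have "((\<alpha> / t * A * G + - g / (1 - t) * G * A) * ((1 - t) * K)
        + - real (Suc k) * K * (A * G)) * poly f t + poly (pderiv f) t * (A * G * ((1 - t) * K))
      = A * G * K * poly (jp_step \<alpha> (g + real (Suc k)) f) t"
  proof -
    \<comment> \<open>Naming the quotient leaves a polynomial identity modulo
      \<open>Y * (1 - t) = - g\<close>, which \<open>algebra\<close> can decide.\<close>
    define Y where "Y = - g / (1 - t)"
    have "Y * (1 - t) = - g" using assms by (simp add: Y_def)
    then show ?thesis
      unfolding poly_jp_step[OF assms(1) less_imp_neq[OF assms(2), symmetric]] Y_def[symmetric]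
      by algebra
  qed
  ultimately show "((\<lambda>u. jp_weight \<alpha> g u * (1 - u) ^ Suc k * poly f u) has_field_derivative
    jp_weight \<alpha> g t * (1 - t) ^ k * poly (jp_step \<alpha> (g + real (Suc k)) f) t) (at t)"
    unfolding jp_weight_def A_def G_def K_def by simp
qed

text \<open>The innermost derivative is taken first and becomes one \<open>jp_step\<close>.
  Vanishing to order \<open>k\<close> at the start ensures that every intermediate polynomial still
  vanishes at \<open>0\<close>.\<close>

lemma higher_deriv_jp_weight:
  assumes "\<And>i. i < k \<Longrightarrow> coeff f i = 0" "0 < t" "t < 1"
  shows "(deriv ^^ k) (\<lambda>u. jp_weight \<alpha> g u * (1 - u) ^ k * poly f u) t
    = jp_weight \<alpha> g t * poly (jp_steps \<alpha> g k f) t"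
  using assms(1)
proof (induction k arbitrary: f)
  case (Suc k)
  have "(deriv ^^ Suc k) (\<lambda>u. jp_weight \<alpha> g u * (1 - u) ^ Suc k * poly f u) t
    = (deriv ^^ k) (\<lambda>u. jp_weight \<alpha> g u * (1 - u) ^ k
         * poly (jp_step \<alpha> (g + real (Suc k)) f) u) t"
    unfolding funpow_Suc_right o_def
    by (rule higher_deriv_cong_open[of "{0<..<1}"])
       (use assms(2,3) Suc.prems deriv_jp_weight in auto)
  also have "\<dots> = jp_weight \<alpha> g t * poly (jp_steps \<alpha> g k (jp_step \<alpha> (g + real (Suc k)) f)) t"
    by (rule Suc.IH) (simp add: coeff_jp_step Suc.prems)
  finally show ?case by simp
qed simp

lemma rodrigues_op_eq_jp_steps:
  assumes "\<And>i. i < k \<Longrightarrow> coeff p i = 0" "\<And>t. t \<in> {0<..<1} \<Longrightarrow> f t = poly p t"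
    and "0 < t" "t < 1"
  shows "rodrigues_op \<alpha> g k f t = poly (jp_steps \<alpha> g k p) t"
proof -
  have "(deriv ^^ k) (\<lambda>u. jp_weight \<alpha> g u * (1 - u) ^ k * f u) t
      = (deriv ^^ k) (\<lambda>u. jp_weight \<alpha> g u * (1 - u) ^ k * poly p u) t"
    by (rule higher_deriv_cong_open[of "{0<..<1}"]) (use assms in auto)
  moreover have "jp_weight \<alpha> g t \<noteq> 0"
    using assms by (simp add: jp_weight_def)
  ultimately show ?thesis
    using assms by (simp add: rodrigues_op_def higher_deriv_jp_weight)
qed

definition jp_fold :: "real \<Rightarrow> (nat \<Rightarrow> real) \<Rightarrow> (nat \<Rightarrow> nat) \<Rightarrow> nat list \<Rightarrow> real poly \<Rightarrow> real poly"
  where "jp_fold \<alpha> \<gamma> k = fold (\<lambda>l. jp_steps \<alpha> (\<gamma> l) (k l))"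

lemma low_coeffs_jp_fold:
  assumes "\<And>i. i < e + sum_list (map k xs) \<Longrightarrow> coeff f i = 0" "i < e"
  shows "coeff (jp_fold \<alpha> \<gamma> k xs f) i = 0"
  using assms
proof (induction xs arbitrary: f)
  case (Cons x xs)
  show ?case
    unfolding jp_fold_def fold.simps o_def
    by (rule Cons.IH[unfolded jp_fold_def])
       (auto intro!: low_coeffs_jp_steps[where e = "e + sum_list (map k xs)"] Cons.prems)
qed (simp add: jp_fold_def)

lemma degree_jp_fold:
  assumes "\<alpha> \<ge> 0" "\<forall>l\<in>set xs. \<gamma> l > -1"
  shows "degree (jp_fold \<alpha> \<gamma> k xs f) = degree f"
  using assms(2)
  by (induction xs arbitrary: f) (simp_all add: jp_fold_def degree_jp_steps[OF assms(1)])

text \<open>The function \<open>f\<close> is related to \<open>p\<close> on the open interval only,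
  because this is all that is known after the first operator. The order of vanishing must suffice
  for all operators in the list together.\<close>

lemma fold_rodrigues_op:
  assumes "\<And>i. i < sum_list (map k xs) \<Longrightarrow> coeff p i = 0"
    and "\<And>t. t \<in> {0<..<1} \<Longrightarrow> f t = poly p t" and "t \<in> {0<..<1}"
  shows "fold (\<lambda>l. rodrigues_op \<alpha> (\<gamma> l) (k l)) xs f t = poly (jp_fold \<alpha> \<gamma> k xs p) t"
  using assms(1,2)
proof (induction xs arbitrary: f p)
  case Nil
  then show ?case using assms(3) by (simp add: jp_fold_def)
next
  case (Cons x xs)
  have "fold (\<lambda>l. rodrigues_op \<alpha> (\<gamma> l) (k l)) xs (rodrigues_op \<alpha> (\<gamma> x) (k x) f) t
      = poly (jp_fold \<alpha> \<gamma> k xs (jp_steps \<alpha> (\<gamma> x) (k x) p)) t"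
  proof (rule Cons.IH)
    show "coeff (jp_steps \<alpha> (\<gamma> x) (k x) p) i = 0" if "i < sum_list (map k xs)" for i
      by (rule low_coeffs_jp_steps[where e = "sum_list (map k xs)"])
         (use that Cons.prems in auto)
    show "rodrigues_op \<alpha> (\<gamma> x) (k x) f t = poly (jp_steps \<alpha> (\<gamma> x) (k x) p) t"
      if "t \<in> {0<..<1}" for t
      using that Cons.prems by (intro rodrigues_op_eq_jp_steps) auto
  qed
  then show ?case by (simp add: jp_fold_def)
qed

section \<open>Moments and orthogonality of Jacobi-Pineiro polynomials\<close>

text \<open>The integral of \<open>f t * t ^ s\<close> against the weight, expanded termwise into
  Beta values, so that the recurrence of the Beta function can replace integration by parts.\<close>

definition jp_moment :: "real \<Rightarrow> real \<Rightarrow> nat \<Rightarrow> real poly \<Rightarrow> real" where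
  "jp_moment \<alpha> g s f = (\<Sum>i\<le>degree f. coeff f i * Beta (\<alpha> + real i + real s + 1) (g + 1))"

lemma jp_moment_eq:
  assumes "degree f \<le> N"
  shows "jp_moment \<alpha> g s f = (\<Sum>i\<le>N. coeff f i * Beta (\<alpha> + real i + real s + 1) (g + 1))"
  unfolding jp_moment_def
  by (rule sum.mono_neutral_left) (use assms in \<open>auto simp: coeff_eq_0\<close>)

text \<open>Integration by parts in algebraic form. With this parameter the step is
  \<open>D(\<omega> (1 - t) f) / \<omega> - s f\<close>; against \<open>t ^ s\<close> the first term
  contributes \<open>- s\<close> times the integral of
  \<open>t ^ (s - 1) (1 - t) f \<omega>\<close>, and \<open>(1 - t) + t = 1\<close> merges both
  terms. For \<open>s = 0\<close> the truncated \<open>s - 1\<close> is multiplied by zero.\<close>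

lemma jp_moment_jp_step:
  assumes "\<alpha> \<ge> 0" "g > -1" "coeff f 0 = 0"
  shows "jp_moment \<alpha> g s (jp_step \<alpha> (g + real (Suc s)) f) = - real s * jp_moment \<alpha> g (s - 1) f"
proof -
  define B where "B i = Beta (\<alpha> + real i + real s) (g + 1)" for i
  define N where "N = Suc (degree f)"
  have B: "(real i + \<alpha> + g + real (Suc s)) * B (Suc i) = (\<alpha> + real i + real s) * B i" 
    if "i > 0" for i
  proof -
    have "\<alpha> + real i + real s \<notin> \<int>\<^sub>\<le>\<^sub>0"
      using assms that by (auto dest: nonpos_Ints_nonpos)
    from Beta_plus1_left[OF this, of "g + 1"] show ?thesis
      by (simp add: B_def algebra_simps)
  qed
  have "jp_moment \<alpha> g s (jp_step \<alpha> (g + real (Suc s)) f)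
      = (\<Sum>i\<le>N. coeff (jp_step \<alpha> (g + real (Suc s)) f) i * B (Suc i))"
    by (subst jp_moment_eq[of _ N])
       (use assms in \<open>auto simp: N_def B_def degree_jp_step algebra_simps\<close>)
  also have "\<dots> = (\<Sum>i\<le>N. (real (Suc i) + \<alpha>) * coeff f (Suc i) * B (Suc i))
        - (\<Sum>i\<le>N. (real i + \<alpha> + g + real (Suc s)) * coeff f i * B (Suc i))"
    by (simp add: coeff_jp_step algebra_simps sum_subtractf sum.distrib)
  also have "(\<Sum>i\<le>N. (real (Suc i) + \<alpha>) * coeff f (Suc i) * B (Suc i))
        = (\<Sum>i\<le>Suc N. (real i + \<alpha>) * coeff f i * B i)"
    by (subst sum.atMost_Suc_shift) (simp add: assms)
  also have "\<dots> = (\<Sum>i\<le>N. (real i + \<alpha>) * coeff f i * B i)"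
    by (simp add: N_def coeff_eq_0)
  also have "\<dots> - (\<Sum>i\<le>N. (real i + \<alpha> + g + real (Suc s)) * coeff f i * B (Suc i))
     = (\<Sum>i\<le>N. coeff f i * ((real i + \<alpha>) * B i - (real i + \<alpha> + g + real (Suc s)) * B (Suc i)))"
    by (simp add: sum_subtractf algebra_simps)
  also have "\<dots> = (\<Sum>i\<le>N. coeff f i * (- real s * B i))"
  proof (rule sum.cong)
    fix i
    show "coeff f i * ((real i + \<alpha>) * B i - (real i + \<alpha> + g + real (Suc s)) * B (Suc i))
        = coeff f i * (- real s * B i)"
      using B[of i] assms(3) by (cases "i = 0") (simp_all add: algebra_simps)
  qed simp
  also have "\<dots> = - real s * (\<Sum>i\<le>N. coeff f i * B i)"
    by (simp add: sum_distrib_left algebra_simps sum_negf)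
  also have "\<dots> = - real s * jp_moment \<alpha> g (s - 1) f"
    by (cases s) (simp_all add: jp_moment_eq[of _ N] N_def B_def algebra_simps)
  finally show ?thesis .
qed

text \<open>For the top order \<open>s = k\<close>, the step with parameter \<open>g + k + 1\<close>
  is commuted to the outside and lowers the order by one, or gives the factor \<open>0\<close> if
  \<open>k = 0\<close>. For smaller \<open>s\<close> that step stays innermost and the induction
  hypothesis applies to its result.\<close>

lemma jp_moment_jp_steps:
  assumes "\<alpha> \<ge> 0" "g > -1" "\<And>i. i < k \<Longrightarrow> coeff f i = 0" "s < k"
  shows "jp_moment \<alpha> g s (jp_steps \<alpha> g k f) = 0"
  using assms(3,4)
proof (induction k arbitrary: f s)
  case (Suc k)
  show ?case
  proof (cases "s = k")
    case True
    have "coeff (jp_steps \<alpha> g k f) 0 = 0"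
      by (rule low_coeffs_jp_steps[where e = 1]) (use Suc.prems in auto)
    then have "jp_moment \<alpha> g k (jp_step \<alpha> (g + real (Suc k)) (jp_steps \<alpha> g k f))
       = - real k * jp_moment \<alpha> g (k - 1) (jp_steps \<alpha> g k f)"
      using assms by (intro jp_moment_jp_step)
    also have "\<dots> = 0"
      using Suc.IH[of f "k - 1"] Suc.prems by (cases "k = 0") auto
    finally show ?thesis using True by (simp add: jp_steps_jp_step)
  next
    case False
    then show ?thesis
      using Suc.prems by (auto simp: coeff_jp_step intro!: Suc.IH)
  qed
qed simp

lemma integral_poly_jp_weight:
  assumes "\<alpha> \<ge> 0" "g > -1"
  shows "set_integrable lborel {0..1} (\<lambda>t. poly p t * t ^ s * jp_weight \<alpha> g t)"
    and "(LBINT t:{0..1}. poly p t * t ^ s * jp_weight \<alpha> g t) = jp_moment \<alpha> g s p"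
proof -
  define \<omega> where "\<omega> i = (\<lambda>t. t powr (\<alpha> + real i + real s + 1 - 1) * (1 - t) powr (g + 1 - 1))"
    for i :: nat
  have int: "set_integrable lborel {0..1} (\<omega> i)" for i
    unfolding \<omega>_def by (rule integrable_Beta) (use assms in auto)
  have val: "(LBINT t:{0..1}. \<omega> i t) = Beta (\<alpha> + real i + real s + 1) (g + 1)" for i
    using set_borel_integral_eq_integral(2)[OF int[of i]]
      has_integral_Beta_real[of "\<alpha> + real i + real s + 1" "g + 1"] assms
    by (simp add: \<omega>_def has_integral_iff)
  \<comment> \<open>At \<open>t = 0\<close> both sides are zero, since \<open>0 powr x = 0\<close>
    for every \<open>x\<close>, including \<open>x = 0\<close>.\<close>
  have pow: "t ^ i * t ^ s * t powr \<alpha> = t powr (\<alpha> + real i + real s)" if "t \<ge> 0" for i t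
    using that by (cases "t = 0") (simp_all add: powr_add powr_realpow)
  have eq: "poly p t * t ^ s * jp_weight \<alpha> g t = (\<Sum>i\<le>degree p. coeff p i * \<omega> i t)"
    if "t \<in> {0..1}" for t
    using that
    by (simp add: poly_altdef jp_weight_def \<omega>_def sum_distrib_right flip: pow)
       (simp add: mult.assoc)
  have int': "set_integrable lborel {0..1} (\<lambda>t. \<Sum>i\<le>degree p. coeff p i * \<omega> i t)"
    using int by (auto simp: set_integrable_def sum_distrib_left mult.left_commute)
  then show "set_integrable lborel {0..1} (\<lambda>t. poly p t * t ^ s * jp_weight \<alpha> g t)"
    by (subst set_integrable_cong[OF refl refl eq])
  have "(LBINT t:{0..1}. poly p t * t ^ s * jp_weight \<alpha> g t)
     = (LBINT t:{0..1}. \<Sum>i\<le>degree p. coeff p i * \<omega> i t)"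
    by (rule set_lebesgue_integral_cong) (use eq in auto)
  also have "\<dots> = (\<Sum>i\<le>degree p. LBINT t:{0..1}. coeff p i * \<omega> i t)"
    using int by (simp add: set_lebesgue_integral_def set_integrable_def sum_distrib_left
      mult.left_commute)
  also have "\<dots> = jp_moment \<alpha> g s p"
    by (simp add: jp_moment_def val)
  finally show "(LBINT t:{0..1}. poly p t * t ^ s * jp_weight \<alpha> g t) = jp_moment \<alpha> g s p" .
qed

lemma type_II_jp_jp_fold:
  assumes "\<alpha> \<ge> 0" "\<forall>l\<in>{1..r}. \<gamma> l > -1"
  shows "type_II_jp \<alpha> r \<gamma> k (jp_fold \<alpha> \<gamma> k [1..<Suc r] (monom 1 (\<Sum>l=1..r. k l)))"
    (is "type_II_jp _ _ _ _ (jp_fold _ _ _ ?xs (monom 1 ?N))")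
  unfolding type_II_jp_def
proof (intro conjI ballI allI impI)
  have N: "?N = sum_list (map k ?xs)"
    by (simp add: interv_sum_list_conv_sum_set_nat atLeastLessThanSuc_atLeastAtMost del: upt_Suc)
  show "degree (jp_fold \<alpha> \<gamma> k ?xs (monom 1 ?N)) = ?N"
    using assms by (subst degree_jp_fold) (auto simp: degree_monom_eq)
  fix l s assume l: "l \<in> {1..r}" and s: "s < k l"
  define ys where "ys = remove1 l ?xs"
  have mset: "mset ?xs = mset (ys @ [l])"
    using l by (simp add: ys_def del: upt_Suc)
  \<comment> \<open>Commuting operators make the fold depend only on the multiset of indices, so
    \<open>l\<close> may be moved to the end.\<close>
  have "jp_fold \<alpha> \<gamma> k ?xs = jp_fold \<alpha> \<gamma> k (ys @ [l])"
    unfolding jp_fold_def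
    by (rule fold_multiset_equiv[OF _ mset]) (simp add: fun_eq_iff jp_steps_commute)
  then have fold: "jp_fold \<alpha> \<gamma> k ?xs (monom 1 ?N)
      = jp_steps \<alpha> (\<gamma> l) (k l) (jp_fold \<alpha> \<gamma> k ys (monom 1 ?N))"
    by (simp add: jp_fold_def del: upt_Suc)
  \<comment> \<open>The operators in \<open>ys\<close> use up all of the vanishing order of the
    monomial except \<open>k l\<close>, just what the last operator requires.\<close>
  have "?N = k l + sum_list (map k ys)"
    unfolding N using arg_cong[OF mset, of "\<lambda>M. sum_mset (image_mset k M)"]
    by (simp flip: sum_mset_sum_list del: upt_Suc)
  then have "coeff (jp_fold \<alpha> \<gamma> k ys (monom 1 ?N)) i = 0" if "i < k l" for i
    by (intro low_coeffs_jp_fold[where e = "k l"]) (use that in auto)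
  then show "(LBINT t:{0..1}. poly (jp_fold \<alpha> \<gamma> k ?xs (monom 1 ?N)) t * t ^ s
      * jp_weight \<alpha> (\<gamma> l) t) = 0"
    unfolding fold using assms l s
    by (subst integral_poly_jp_weight(2)) (auto intro!: jp_moment_jp_steps)
qed

text \<open>The definite description is resolved by the explicit polynomial \<open>?p\<close>;
  uniqueness follows from the prescribed values on the open interval alone.\<close>

lemma type_II_jp_jacobi_pineiro:
  assumes "\<alpha> \<ge> 0" "\<forall>l\<in>{1..r}. \<gamma> l > -1"
  shows "type_II_jp \<alpha> r \<gamma> k (jacobi_pineiro \<alpha> r \<gamma> k)"
proof -
  let ?p = "jp_fold \<alpha> \<gamma> k [1..<Suc r] (monom 1 (\<Sum>l=1..r. k l))"
  let ?P = "\<lambda>p. type_II_jp \<alpha> r \<gamma> k p \<and> (\<forall>t\<in>{0<..<1}. poly p t = rodrigues \<alpha> r \<gamma> k t)"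
  have rod: "\<forall>t\<in>{0<..<1}. poly ?p t = rodrigues \<alpha> r \<gamma> k t"
    unfolding rodrigues_def
    by (intro ballI fold_rodrigues_op[symmetric])
       (auto simp: poly_monom interv_sum_list_conv_sum_set_nat 
          atLeastLessThanSuc_atLeastAtMost simp del: upt_Suc)
  have "p = ?p" if "?P p" for p
  proof (rule poly_eqI_degree)
    \<comment> \<open>Distinct points of the open interval, one more than the larger degree.\<close>
    let ?A = "(\<lambda>i. 1 / real (i + 2)) ` {..max (degree p) (degree ?p)}"
    have "card ?A = Suc (max (degree p) (degree ?p))"
      by (subst card_image) (auto intro!: inj_onI)
    then show "degree p < card ?A" "degree ?p < card ?A"
      by auto
    show "poly p t = poly ?p t" if "t \<in> ?A" for t
      using that rod \<open>?P p\<close> by auto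
  qed
  then have "?P (THE p. ?P p)"
    using rod type_II_jp_jp_fold[OF assms] by (intro theI[of ?P ?p]) auto
  then show ?thesis by (simp add: jacobi_pineiro_def)
qed

section \<open>Gegenbauer and Chebyshev polynomials\<close>

text \<open>A Gegenbauer parameter \<open>lam\<close> corresponds to \<open>p = lam - 1/2\<close>;
  the bound \<open>p \<ge> - 1 / 2\<close> below means \<open>lam \<ge> 0\<close> and includes the
  Chebyshev case \<open>lam = 0\<close>.\<close>

definition ultra_integral :: "real \<Rightarrow> real poly \<Rightarrow> real" where
  "ultra_integral p q = (LBINT t:{-1..1}. poly q t * (1 - t\<^sup>2) powr p)"

lemma one_minus_square_pos: "-1 < t \<Longrightarrow> t < 1 \<Longrightarrow> 1 - t\<^sup>2 > (0 :: real)"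
  using mult_pos_pos[of "1 - t" "1 + t"] by (simp add: power2_eq_square algebra_simps)

lemma one_minus_square_nonneg: "-1 \<le> t \<Longrightarrow> t \<le> 1 \<Longrightarrow> 1 - t\<^sup>2 \<ge> (0 :: real)"
  using mult_nonneg_nonneg[of "1 - t" "1 + t"] by (simp add: power2_eq_square algebra_simps)

text \<open>This weight is the derivative of \<open>arcsin\<close>. It dominates all weights with a
  larger exponent, hence yields integrability for them.\<close>

lemma has_integral_arcsin_weight:
  "((\<lambda>t. (1 - t\<^sup>2) powr (- 1 / 2)) has_integral pi) {-1..1}"
proof -
  have "((\<lambda>t. (1 - t\<^sup>2) powr (- 1 / 2)) has_integral arcsin 1 - arcsin (-1)) {-1..1}"
  proof (rule fundamental_theorem_of_calculus_interior)
    fix t :: real assume t: "t \<in> {-1<..<1}"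
    then have "t\<^sup>2 < 1" using one_minus_square_pos[of t] by auto
    then have "(1 - t\<^sup>2) powr (- 1 / 2) = inverse (sqrt (1 - t\<^sup>2))"
      using powr_minus[of "1 - t\<^sup>2" "1/2"] by (simp add: powr_half_sqrt)
    then show "(arcsin has_vector_derivative (1 - t\<^sup>2) powr (- 1 / 2)) (at t)"
      using DERIV_arcsin[of t] t by (simp add: has_real_derivative_iff_has_vector_derivative)
  qed (auto intro: continuous_on_arcsin')
  then show ?thesis by (simp add: arcsin_minus)
qed

lemma ultra_weight_le:
  fixes p t :: real
  assumes "p \<ge> - 1 / 2" "t \<in> {-1..1}"
  shows "(1 - t\<^sup>2) powr p \<le> (1 - t\<^sup>2) powr (- 1 / 2)"
proof -
  have "0 \<le> 1 - t\<^sup>2" "1 - t\<^sup>2 \<le> 1"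
    using assms one_minus_square_nonneg[of t] by auto
  then show ?thesis
    using assms by (cases "1 - t\<^sup>2 = 0") (auto intro: powr_mono')
qed

lemma borel_measurable_poly [measurable]:
  "poly (q :: real poly) \<in> borel_measurable borel"
  by (intro borel_measurable_continuous_onI continuous_on_poly continuous_on_id)

lemma set_integrable_ultra_weight:
  fixes p :: real
  assumes "p \<ge> - 1 / 2"
  shows "set_integrable lborel {-1..1} (\<lambda>t. poly q t * (1 - t\<^sup>2) powr p)"
proof -
  have "(\<lambda>t. (1 - t\<^sup>2) powr (- 1 / 2)) absolutely_integrable_on {-1..1::real}"
    using has_integral_arcsin_weight by (intro nonnegative_absolutely_integrable_1) auto
  then have int: "set_integrable lborel {-1..1} (\<lambda>t::real. (1 - t\<^sup>2) powr (- 1 / 2))"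
    unfolding set_integrable_def by (subst (asm) integrable_completion) auto
  have "compact (poly q ` {-1..1})"
    by (intro compact_continuous_image continuous_on_poly continuous_on_id compact_Icc)
  then obtain B where B: "\<And>t. t \<in> {-1..1} \<Longrightarrow> \<bar>poly q t\<bar> \<le> B"
    by (meson bounded_real compact_imp_bounded image_eqI)
  show ?thesis
  proof (rule set_integrable_bound[OF set_integrable_mult_right[where a = B, OF int]])
    show "AE t in lborel. t \<in> {-1..1} \<longrightarrow>
       norm (poly q t * (1 - t\<^sup>2) powr p) \<le> norm (B * (1 - t\<^sup>2) powr (- 1 / 2))"
      using B ultra_weight_le[OF assms] 
      by (intro AE_I2 impI) (fastforce simp: abs_mult intro!: mult_mono)
  qed (auto simp: set_borel_measurable_def)
qed

context
  fixes p :: real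
  assumes p: "p \<ge> - 1 / 2"
begin

lemma ultra_integral_add: "ultra_integral p (q + r) = ultra_integral p q + ultra_integral p r"
  using set_integrable_ultra_weight[OF p]
  by (simp add: ultra_integral_def distrib_right set_integral_add)

lemma ultra_integral_smult: "ultra_integral p (smult c q) = c * ultra_integral p q"
  by (simp add: ultra_integral_def mult.assoc)

lemma ultra_integral_diff: "ultra_integral p (q - r) = ultra_integral p q - ultra_integral p r"
  using ultra_integral_add[of q "smult (-1) r"] ultra_integral_smult[of "-1" r] by simp

lemma ultra_integral_sum: "ultra_integral p (sum f A) = (\<Sum>i\<in>A. ultra_integral p (f i))"
proof (induction A rule: infinite_finite_induct)
  case (infinite A)
  then show ?case by (simp add: ultra_integral_def)
next
  case empty
  then show ?case by (simp add: ultra_integral_def)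
qed (simp add: ultra_integral_add)

text \<open>Positive definiteness: the weight is positive inside the interval, so \<open>q\<close>
  would vanish almost everywhere there, whereas a nonzero polynomial has finitely many
  roots.\<close>

lemma ultra_integral_eq_0_imp:
  assumes nonneg: "\<And>t. t \<in> {-1..1} \<Longrightarrow> poly q t \<ge> 0" and 0: "ultra_integral p q = 0"
  shows "q = 0"
proof (rule ccontr)
  assume "q \<noteq> 0"
  have "AE t in lborel. indicator {-1..1} t *\<^sub>R (poly q t * (1 - t\<^sup>2) powr p) = 0"
    using 0 set_integrable_ultra_weight[OF p, of q] nonneg
    unfolding ultra_integral_def set_lebesgue_integral_def set_integrable_def
    by (subst (asm) integral_nonneg_eq_0_iff_AE) (auto simp: indicator_def)
  then have ae: "AE t in lborel. t \<notin> {-1<..<1} \<or> poly q t = 0"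
  proof eventually_elim
    case (elim t)
    have "1 - t\<^sup>2 > 0" if "t \<in> {-1<..<1}"
      using that one_minus_square_pos[of t] by auto
    with elim show ?case by (auto simp: indicator_def split: if_splits)
  qed
  have "finite {t. poly q t = 0}"
    using \<open>q \<noteq> 0\<close> by (rule poly_roots_finite)
  then have "AE t in lborel. t \<notin> {t. poly q t = 0}"
    by (intro AE_not_in finite_imp_null_set_lborel)
  with ae have "AE t in lborel. t \<notin> {-1<..<1::real}"
    by eventually_elim auto
  then have "emeasure lborel {-1<..<1::real} = 0"
    by (subst (asm) AE_iff_measurable[where N = "{-1<..<1}"]) auto
  then show False by simp
qed

end

lemma ultra_integral_reflect: "ultra_integral p (pcompose q [:0, -1:]) = ultra_integral p q"
proof -
  have "ultra_integral p q
      = (\<integral>t. indicator {-1..1} t *\<^sub>R (poly q t * (1 - t\<^sup>2) powr p) \<partial>lborel)"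
    by (simp add: ultra_integral_def set_lebesgue_integral_def)
  also have "\<dots> = \<bar>-1\<bar> *\<^sub>R (\<integral>t. indicator {-1..1} (0 + (-1) * t) *\<^sub>R
      (poly q (0 + (-1) * t) * (1 - (0 + (-1) * t)\<^sup>2) powr p) \<partial>lborel)"
    by (rule lborel_integral_real_affine) simp
  also have "\<dots> = ultra_integral p (pcompose q [:0, -1:])"
    unfolding ultra_integral_def set_lebesgue_integral_def
    by (simp add: poly_pcompose) (auto intro!: Bochner_Integration.integral_cong simp: indicator_def)
  finally show ?thesis by simp
qed

text \<open>Raising the exponent by a natural number amounts to a polynomial factor, so
  orthogonality for the original weight remains applicable.\<close>

lemma ultra_integral_shift:
  "ultra_integral (p + real e) q = ultra_integral p (q * [:1, 0, -1:] ^ e)"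
  unfolding ultra_integral_def
proof (rule set_lebesgue_integral_cong)
  show "\<forall>t. t \<in> {-1..1} \<longrightarrow> poly q t * (1 - t\<^sup>2) powr (p + real e)
      = poly (q * [:1, 0, -1:] ^ e) t * (1 - t\<^sup>2) powr p"
  proof (intro allI impI)
    fix t :: real assume "t \<in> {-1..1}"
    then have "1 - t\<^sup>2 \<ge> 0" using one_minus_square_nonneg[of t] by simp
    then show "poly q t * (1 - t\<^sup>2) powr (p + real e)
      = poly (q * [:1, 0, -1:] ^ e) t * (1 - t\<^sup>2) powr p"
      by (cases "1 - t\<^sup>2 = 0") (simp_all add: powr_add powr_realpow power2_eq_square)
  qed
qed simp

section \<open>Orthogonal polynomials for ultraspherical weights\<close>

text \<open>The degree is only bounded, which spares computing leading coefficients of the Chebyshev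
  polynomials.\<close>

definition ultra_orthogonal :: "real \<Rightarrow> nat \<Rightarrow> real poly \<Rightarrow> bool" where
  "ultra_orthogonal lam m q \<longleftrightarrow>
     degree q \<le> m \<and> (\<forall>s<m. ultra_integral (lam - 1/2) (q * monom 1 s) = 0)"

lemma ultra_orthogonalD:
  assumes "lam \<ge> 0" "ultra_orthogonal lam m q" "\<And>i. i \<ge> m \<Longrightarrow> coeff r i = 0"
  shows "ultra_integral (lam - 1/2) (q * r) = 0"
proof -
  have "q * r = (\<Sum>i\<le>degree r. smult (coeff r i) (q * monom 1 i))"
    by (subst poly_as_sum_of_monoms[symmetric, of r])
       (simp add: sum_distrib_left smult_monom flip: mult_smult_right)
  then have "ultra_integral (lam - 1/2) (q * r)
     = (\<Sum>i\<le>degree r. coeff r i * ultra_integral (lam - 1/2) (q * monom 1 i))"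
    using assms(1) by (simp add: ultra_integral_sum ultra_integral_smult)
  also have "\<dots> = 0"
    using assms(2,3) by (intro sum.neutral ballI) (metis mult_eq_0_iff not_le ultra_orthogonal_def)
  finally show ?thesis .
qed

text \<open>The difference \<open>r\<close> of the reflected \<open>q\<close> and
  \<open>(-1) ^ m\<close> times \<open>q\<close> has no coefficients from \<open>m\<close> on. It is
  orthogonal to \<open>q\<close> and, by reflection, to the reflected \<open>q\<close>; hence it is
  orthogonal to itself and zero.\<close>

lemma ultra_orthogonal_uminus:
  assumes lam: "lam \<ge> 0" and orth: "ultra_orthogonal lam m q"
  shows "poly q (- t) = (-1) ^ m * poly q t"
proof -
  have p: "lam - 1/2 \<ge> - 1 / 2" using lam by simp
  let ?n = "\<lambda>q. pcompose q [:0, -1:] :: real poly"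
  define r where "r = ?n q - smult ((-1) ^ m) q"
  have cn: "coeff (?n f) i = (-1) ^ i * coeff f i" for f i
    using coeff_pcompose_linear[of f "-1" i] by simp
  have r0: "coeff r i = 0" if "i \<ge> m" for i
    using orth that coeff_eq_0[of q i]
    by (cases "i = m") (auto simp: r_def cn ultra_orthogonal_def)
  have nn: "?n (?n f) = f" for f
    by (intro poly_eqI) (simp add: cn flip: power_mult_distrib mult.assoc)
  have "ultra_integral (lam - 1/2) (?n q * r) = ultra_integral (lam - 1/2) (?n (?n q * r))"
    by (simp add: ultra_integral_reflect)
  also have "?n (?n q * r) = q * ?n r" by (simp add: pcompose_mult nn)
  also have "ultra_integral (lam - 1/2) (q * ?n r) = 0"
    using lam orth by (rule ultra_orthogonalD) (simp add: cn r0)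
  finally have "ultra_integral (lam - 1/2) (?n q * r) = 0" .
  moreover have "ultra_integral (lam - 1/2) (q * r) = 0"
    using lam orth by (rule ultra_orthogonalD) (simp add: r0)
  moreover have "r * r = ?n q * r - smult ((-1) ^ m) (q * r)"
    by (simp add: r_def left_diff_distrib)
  ultimately have "ultra_integral (lam - 1/2) (r * r) = 0"
    by (simp add: ultra_integral_diff[OF p] ultra_integral_smult[OF p])
  then have "r * r = 0"
    by (rule ultra_integral_eq_0_imp[OF p, rotated]) simp
  then have "poly (?n q) t = poly (smult ((-1) ^ m) q) t"
    by (simp add: r_def)
  then show ?thesis by (simp add: poly_pcompose)
qed

text \<open>In the first case the shifted weight turns into a polynomial of degree below
  \<open>m\<close>; in the second the integrand is odd by the parity of \<open>q\<close>.\<close>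

lemma ultra_integral_orthogonal_eq_0:
  assumes lam: "lam \<ge> 0" and orth: "ultra_orthogonal lam m q"
    and "a + 2 * e < m \<or> odd (a + m)"
  shows "ultra_integral (lam - 1/2 + real e) (q * monom 1 a) = 0"
  using assms(3)
proof
  assume "a + 2 * e < m"
  have "degree (monom 1 a * [:1, 0, -1:] ^ e :: real poly) \<le> a + 2 * e"
    by (rule order.trans[OF degree_mult_le add_mono[OF degree_monom_le order.trans[OF degree_power_le]]])
       simp
  then have "ultra_integral (lam - 1/2) (q * (monom 1 a * [:1, 0, -1:] ^ e)) = 0"
    using \<open>a + 2 * e < m\<close> by (intro ultra_orthogonalD[OF lam orth] coeff_eq_0) auto
  then show ?thesis by (simp add: ultra_integral_shift mult.assoc)
next
  assume odd: "odd (a + m)"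
  have "poly (pcompose (q * monom 1 a) [:0, -1:]) t = poly (smult (-1) (q * monom 1 a)) t" for t
  proof -
    have "(-1) ^ m * (- t) ^ a = - (t ^ a)"
      using odd by (cases "even m") (auto simp: power_minus[of t])
    then show ?thesis
      by (simp add: poly_pcompose poly_monom ultra_orthogonal_uminus[OF lam orth] ac_simps)
  qed
  then have "pcompose (q * monom 1 a) [:0, -1:] = smult (-1) (q * monom 1 a)"
    by (metis poly_eq_poly_eq_iff ext)
  then have "ultra_integral (lam - 1/2 + real e) (q * monom 1 a)
      = - ultra_integral (lam - 1/2 + real e) (q * monom 1 a)"
    using ultra_integral_reflect[of "lam - 1/2 + real e" "q * monom 1 a"]
      ultra_integral_smult[of "lam - 1/2 + real e" "-1" "q * monom 1 a"] lam
    by simp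
  then show ?thesis by simp
qed

lemma poly_span_of_degrees:
  assumes "\<And>j. j < k \<Longrightarrow> degree (P j) = j \<and> P j \<noteq> 0" "\<And>i. i \<ge> k \<Longrightarrow> coeff r i = 0"
  shows "\<exists>c. (r :: real poly) = (\<Sum>j<k. smult (c j) (P j))"
  using assms
proof (induction k arbitrary: r)
  case 0
  then show ?case by (auto intro: poly_eqI)
next
  case (Suc k)
  define a where "a = coeff r k / lead_coeff (P k)"
  have "\<exists>c. r - smult a (P k) = (\<Sum>j<k. smult (c j) (P j))"
  proof (rule Suc.IH)
    fix i assume "i \<ge> k"
    then show "coeff (r - smult a (P k)) i = 0"
      using Suc.prems(1)[of k] Suc.prems(2)[of i] coeff_eq_0[of "P k" i]
        leading_coeff_0_iff[of "P k"]
      by (cases "i = k") (auto simp: a_def simp del: leading_coeff_0_iff)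
  qed (use Suc.prems(1) in auto)
  then obtain c where "r = (\<Sum>j<k. smult (c j) (P j)) + smult a (P k)"
    by (auto simp: algebra_simps)
  also have "\<dots> = (\<Sum>j<Suc k. smult ((c(k := a)) j) (P j))"
    by simp
  finally show ?case by blast
qed

text \<open>Gram-Schmidt: the projections onto the earlier polynomials are subtracted from the
  monomial; their squared norms are nonzero by positive definiteness.\<close>

lemma ultra_orthogonal_exists:
  assumes lam: "lam \<ge> 0"
  shows "\<exists>q. degree q = m \<and> q \<noteq> 0 \<and> ultra_orthogonal lam m q"
proof (induction m rule: less_induct)
  case (less m)
  let ?L = "ultra_integral (lam - 1/2)"
  have p: "lam - 1/2 \<ge> - 1 / 2" using lam by simp
  from less obtain P where P: "\<And>i. i < m \<Longrightarrow> degree (P i) = i \<and> P i \<noteq> 0 \<and> ultra_orthogonal lam i (P i)"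
    by metis
  define c where "c i = ?L (monom 1 m * P i) / ?L (P i * P i)" for i
  define S where "S = (\<Sum>i<m. smult (c i) (P i))"
  define q where "q = monom 1 m - S"
  have pos: "?L (P i * P i) \<noteq> 0" if "i < m" for i
    using ultra_integral_eq_0_imp[OF p, of "P i * P i"] P[OF that] by auto
  have PP: "?L (P i * P j) = 0" if "i < m" "j < m" "i \<noteq> j" for i j
  proof -
    have *: "?L (P i * P j) = 0" if "j < i" "i < m" for i j
      using that P[of i] P[of j] by (intro ultra_orthogonalD[OF lam]) (auto intro: coeff_eq_0)
    show ?thesis using *[of i j] *[of j i] that by (auto simp: mult.commute neq_iff)
  qed
  have qP: "?L (q * P j) = 0" if "j < m" for j
  proof -
    have "?L (S * P j) = (\<Sum>i<m. c i * ?L (P i * P j))"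
      by (simp add: S_def sum_distrib_right ultra_integral_sum[OF p] ultra_integral_smult[OF p])
    also have "\<dots> = (\<Sum>i<m. if i = j then c j * ?L (P j * P j) else 0)"
      by (rule sum.cong) (use PP that in auto)
    also have "\<dots> = ?L (monom 1 m * P j)"
      using that pos by (simp add: c_def)
    finally show ?thesis
      by (simp add: q_def left_diff_distrib ultra_integral_diff[OF p])
  qed
  have Sc: "coeff S i = 0" if "i \<ge> m" for i
    using that P by (auto simp: S_def coeff_sum intro!: sum.neutral coeff_eq_0)
  then have qc: "coeff q m = 1" and "degree q \<le> m"
    by (auto simp: q_def intro!: degree_le)
  moreover have "degree q \<ge> m" using qc by (intro le_degree) simp
  ultimately have "degree q = m" "q \<noteq> 0" by auto
  moreover have "ultra_orthogonal lam m q"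
    unfolding ultra_orthogonal_def
  proof (intro conjI allI impI)
    fix s assume "s < m"
    \<comment> \<open>Orthogonality to all \<open>P j\<close> passes to the monomials of degree
      below \<open>m\<close>, because these lie in the span.\<close>
    then obtain b where b: "monom 1 s = (\<Sum>j<m. smult (b j) (P j))"
      using poly_span_of_degrees[of m P "monom 1 s"] P by auto
    show "?L (q * monom 1 s) = 0"
      unfolding b using qP
      by (simp add: sum_distrib_left ultra_integral_sum[OF p] ultra_integral_smult[OF p])
  qed (use \<open>degree q = m\<close> in simp)
  ultimately show ?case by blast
qed

text \<open>A zero at \<open>1\<close> would give \<open>q = (t - 1) s\<close> with \<open>s\<close>
  of lower degree, hence orthogonal to \<open>q\<close>; but \<open>q s = - (1 - t) s^2\<close> has
  constant sign on the interval. This makes the normalization at \<open>1\<close> possible.\<close>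

lemma ultra_orthogonal_poly_1:
  assumes lam: "lam \<ge> 0" and orth: "ultra_orthogonal lam m q" and "q \<noteq> 0"
  shows "poly q 1 \<noteq> 0"
proof
  have p: "lam - 1/2 \<ge> - 1 / 2" using lam by simp
  assume "poly q 1 = 0"
  then obtain s where s: "q = [:-1, 1:] * s"
    unfolding poly_eq_0_iff_dvd by (elim dvdE)
  with \<open>q \<noteq> 0\<close> have "s \<noteq> 0" by auto
  then have "degree q = Suc (degree s)"
    unfolding s by (subst degree_mult_eq) auto
  then have "ultra_integral (lam - 1/2) (q * s) = 0"
    using orth by (intro ultra_orthogonalD[OF lam orth]) (auto simp: ultra_orthogonal_def intro: coeff_eq_0)
  moreover have "q * s = smult (-1) ([:1, -1:] * (s * s))"
    by (simp only: s mult.assoc) simp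
  ultimately have "ultra_integral (lam - 1/2) ([:1, -1:] * (s * s)) = 0"
    using ultra_integral_smult[OF p, of "-1" "[:1, -1:] * (s * s)"] by simp
  then have "[:1, -1:] * (s * s) = 0"
  proof (rule ultra_integral_eq_0_imp[OF p, rotated])
    fix t :: real assume "t \<in> {-1..1}"
    then have "0 \<le> (1 - t) * (poly s t * poly s t)" by simp
    then show "0 \<le> poly ([:1, -1:] * (s * s)) t" by (simp add: left_diff_distrib)
  qed
  with \<open>s \<noteq> 0\<close> show False unfolding mult_eq_0_iff by simp
qed

lemma ultra_orthogonal_gegenbauer:
  assumes "lam > 0"
  shows "ultra_orthogonal lam m (gegenbauer lam m)"
proof -
  have lam: "lam \<ge> 0" and p: "lam - 1/2 \<ge> - 1 / 2" using assms by auto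
  define N where "N = pochhammer (2 * lam) m / fact m"
  have "N \<noteq> 0"
    using assms pochhammer_pos[of "2 * lam" m] by (simp add: N_def)
  let ?P = "\<lambda>q. degree q = m \<and> ultra_orthogonal lam m q \<and> poly q 1 = N"
  have eq: "gegenbauer lam m = (THE q. ?P q)"
    unfolding gegenbauer_def N_def
    by (rule arg_cong[where f = The])
       (auto simp: fun_eq_iff ultra_orthogonal_def ultra_integral_def poly_monom)
  obtain q where q: "degree q = m" "q \<noteq> 0" "ultra_orthogonal lam m q"
    using ultra_orthogonal_exists[OF lam] by blast
  have q1: "poly q 1 \<noteq> 0"
    using ultra_orthogonal_poly_1[OF lam q(3,2)] .
  define g where "g = smult (N / poly q 1) q"
  have g: "?P g"
    using q q1 \<open>N \<noteq> 0\<close>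
    by (auto simp: g_def ultra_orthogonal_def ultra_integral_smult[OF p])
  have unique: "f = g" if f: "?P f" for f
  proof -
    \<comment> \<open>Cross-multiplying by the leading coefficients cancels the terms of degree
      \<open>m\<close>, so \<open>r\<close> is orthogonal to both candidates and thus to itself. The
      common value at \<open>1\<close> then identifies the leading coefficients.\<close>
    define r where "r = smult (coeff g m) f - smult (coeff f m) g"
    have r0: "coeff r i = 0" if "i \<ge> m" for i
      using that f g coeff_eq_0[of f i] coeff_eq_0[of g i] by (cases "i = m") (auto simp: r_def)
    have "r * r = smult (coeff g m) (f * r) - smult (coeff f m) (g * r)"
      by (simp add: r_def left_diff_distrib)
    moreover have "ultra_integral (lam - 1/2) (f * r) = 0" "ultra_integral (lam - 1/2) (g * r) = 0"
      using f g r0 by (auto intro!: ultra_orthogonalD[OF lam])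
    ultimately have "ultra_integral (lam - 1/2) (r * r) = 0"
      by (simp add: ultra_integral_diff[OF p] ultra_integral_smult[OF p])
    then have "r * r = 0"
      by (rule ultra_integral_eq_0_imp[OF p, rotated]) simp
    then have eq: "smult (coeff g m) f = smult (coeff f m) g"
      by (simp add: r_def)
    from arg_cong[OF this, of "\<lambda>p. poly p 1"] have "coeff g m = coeff f m"
      using f g \<open>N \<noteq> 0\<close> by simp
    moreover have "coeff g m \<noteq> 0"
      using g \<open>N \<noteq> 0\<close> by auto
    ultimately show ?thesis using eq by (simp add: smult_eq_iff)
  qed
  have "?P (THE q. ?P q)"
    using g unique by (rule theI[of ?P])
  then show ?thesis by (simp add: eq)
qed

section \<open>Chebyshev polynomials of the first and second kind\<close>

fun cheb_T :: "nat \<Rightarrow> real poly" where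
  "cheb_T 0 = 1"
| "cheb_T (Suc 0) = [:0, 1:]"
| "cheb_T (Suc (Suc n)) = [:0, 2:] * cheb_T (Suc n) - cheb_T n"

fun cheb_U :: "nat \<Rightarrow> real poly" where
  "cheb_U 0 = 1"
| "cheb_U (Suc 0) = [:0, 2:]"
| "cheb_U (Suc (Suc n)) = [:0, 2:] * cheb_U (Suc n) - cheb_U n"

lemma degree_cheb_T: "degree (cheb_T n) \<le> n"
  by (induction n rule: cheb_T.induct)
     (auto intro!: degree_diff_le order.trans[OF degree_mult_le])

lemma degree_cheb_U: "degree (cheb_U n) \<le> n"
  by (induction n rule: cheb_U.induct)
     (auto intro!: degree_diff_le order.trans[OF degree_mult_le])

lemma poly_cheb_T_cos: "poly (cheb_T n) (cos x) = cos (real n * x)"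
proof (induction n rule: cheb_T.induct)
  case (3 n)
  have "cos (real (Suc (Suc n)) * x) + cos (real n * x) = 2 * cos x * cos (real (Suc n) * x)"
    using cos_plus_cos[of "real (Suc (Suc n)) * x" "real n * x"]
    by (simp add: algebra_simps add_divide_distrib)
  with 3 show ?case by (simp add: algebra_simps)
qed auto

lemma poly_cheb_U_cos: "sin x * poly (cheb_U n) (cos x) = sin (real (Suc n) * x)"
proof (induction n rule: cheb_U.induct)
  case 2
  show ?case using sin_double[of x] by simp
next
  case (3 n)
  have "sin (real (Suc (Suc (Suc n))) * x) + sin (real (Suc n) * x)
      = 2 * cos x * sin (real (Suc (Suc n)) * x)"
    using sin_plus_sin[of "real (Suc (Suc (Suc n))) * x" "real (Suc n) * x"]
    by (simp add: algebra_simps add_divide_distrib)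
  with 3 show ?case by (simp add: algebra_simps)
qed auto

text \<open>The polynomial form of
  \<open>2 sin x sin ((n + 1) x) = cos (n x) - cos ((n + 2) x)\<close>, which carries orthogonality
  over from the first kind to the second.\<close>

lemma cheb_U_eq: "smult 2 ([:1, 0, -1:] * cheb_U n) = cheb_T n - cheb_T (Suc (Suc n))"
proof (induction n rule: cheb_U.induct)
  case (3 n)
  have "smult 2 ([:1, 0, -1:] * cheb_U (Suc (Suc n)))
     = [:0, 2:] * smult 2 ([:1, 0, -1:] * cheb_U (Suc n)) - smult 2 ([:1, 0, -1:] * cheb_U n)"
    by (simp only: cheb_U.simps right_diff_distrib mult.left_commute smult_diff_right
        mult_smult_right)
  also have "\<dots> = cheb_T (Suc (Suc n)) - cheb_T (Suc (Suc (Suc (Suc n))))"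
    unfolding 3 by (simp only: cheb_T.simps algebra_simps)
  finally show ?case .
qed (simp_all add: one_pCons numeral_poly)

text \<open>The antiderivative \<open>?F\<close> vanishes at both ends, where \<open>arccos\<close>
  is \<open>0\<close> and \<open>pi\<close>.\<close>

lemma ultra_integral_cheb_T:
  assumes "n > 0"
  shows "ultra_integral (- 1 / 2) (cheb_T n) = 0"
proof -
  let ?F = "\<lambda>t. - sin (real n * arccos t) / real n"
  have "((\<lambda>t. poly (cheb_T n) t * (1 - t\<^sup>2) powr (- 1 / 2)) has_integral ?F 1 - ?F (-1)) {-1..1}"
  proof (rule fundamental_theorem_of_calculus_interior)
    fix t :: real assume t: "t \<in> {-1<..<1}"
    then have "t\<^sup>2 < 1" using one_minus_square_pos[of t] by auto
    then have w: "(1 - t\<^sup>2) powr (- 1 / 2) = inverse (sqrt (1 - t\<^sup>2))"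
      using powr_minus[of "1 - t\<^sup>2" "1/2"] by (simp add: powr_half_sqrt)
    have "poly (cheb_T n) t = cos (real n * arccos t)"
      using poly_cheb_T_cos[of n "arccos t"] t by simp
    then have "(?F has_real_derivative poly (cheb_T n) t * (1 - t\<^sup>2) powr (- 1 / 2)) (at t)"
      unfolding w using t assms
      by (auto intro!: derivative_eq_intros)
    then show "(?F has_vector_derivative poly (cheb_T n) t * (1 - t\<^sup>2) powr (- 1 / 2)) (at t)"
      by (simp add: has_real_derivative_iff_has_vector_derivative)
  qed (use assms in \<open>auto intro!: continuous_intros continuous_on_arccos'\<close>)
  then have "integral {-1..1} (\<lambda>t. poly (cheb_T n) t * (1 - t\<^sup>2) powr (- 1 / 2)) = 0"
    by (simp add: has_integral_iff)
  then show ?thesis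
    unfolding ultra_integral_def
    by (subst set_borel_integral_eq_integral(2)) (auto intro: set_integrable_ultra_weight)
qed

text \<open>Multiplication by \<open>t\<close> turns \<open>cheb_T n\<close> into the mean of its
  two neighbours, so induction on \<open>s\<close> lowers the power until only integrals of
  Chebyshev polynomials of positive index remain.\<close>

lemma ultra_integral_cheb_T_monom:
  assumes "s < n"
  shows "ultra_integral (- 1 / 2) (cheb_T n * monom 1 s) = 0"
  using assms
proof (induction s arbitrary: n)
  case 0
  then show ?case using ultra_integral_cheb_T by simp
next
  case (Suc s)
  then obtain k where n: "n = Suc k" "s < k" by (cases n) auto
  have "[:0, 1:] * cheb_T (Suc k) = smult (1/2) (cheb_T (Suc (Suc k)) + cheb_T k)"
    by simp
  moreover have "cheb_T n * monom 1 (Suc s) = ([:0, 1:] * cheb_T (Suc k)) * monom 1 s"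
    by (simp add: n monom_Suc)
  ultimately have "cheb_T n * monom 1 (Suc s)
      = smult (1/2) (cheb_T (Suc (Suc k)) * monom 1 s + cheb_T k * monom 1 s)"
    by (simp only: distrib_right mult_smult_left)
  then show ?case
    using Suc.IH[of "Suc (Suc k)"] Suc.IH[of k] n
    by (simp only: ultra_integral_smult[of "-1/2"] ultra_integral_add[of "-1/2"]) simp
qed

lemma ultra_orthogonal_cheb_T: "ultra_orthogonal 0 n (cheb_T n)"
  using ultra_integral_cheb_T_monom by (simp add: ultra_orthogonal_def degree_cheb_T)

text \<open>The weight for \<open>lam = 1\<close> is that for \<open>lam = 0\<close> times
  \<open>1 - t^2\<close>, and \<open>cheb_U_eq\<close> absorbs this factor.\<close>

lemma ultra_orthogonal_cheb_U: "ultra_orthogonal 1 n (cheb_U n)"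
  unfolding ultra_orthogonal_def
proof (intro conjI degree_cheb_U allI impI)
  fix s assume "s < n"
  have "ultra_integral (1 - 1/2) (cheb_U n * monom 1 s)
      = ultra_integral (- 1 / 2 + real 1) (cheb_U n * monom 1 s)" by simp
  also have "\<dots> = ultra_integral (- 1 / 2) (([:1, 0, -1:] * cheb_U n) * monom 1 s)"
    unfolding ultra_integral_shift by (simp only: power_one_right mult_ac)
  also have "[:1, 0, -1:] * cheb_U n = smult (1/2) (cheb_T n - cheb_T (Suc (Suc n)))"
    unfolding cheb_U_eq[symmetric] smult_smult by simp
  also have "ultra_integral (- 1 / 2) (\<dots> * monom 1 s) = ultra_integral (- 1 / 2) (smult (1/2)
      (cheb_T n * monom 1 s - cheb_T (Suc (Suc n)) * monom 1 s))"
    by (simp only: left_diff_distrib mult_smult_left)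
  also have "\<dots> = 0"
    using ultra_integral_cheb_T_monom[of s n] ultra_integral_cheb_T_monom[of s "Suc (Suc n)"]
      \<open>s < n\<close>
    by (simp only: ultra_integral_smult[of "-1/2"] ultra_integral_diff[of "-1/2"]) simp
  finally show "ultra_integral (1 - 1/2) (cheb_U n * monom 1 s) = 0" .
qed

section \<open>Polar coordinates in a half plane\<close>

text \<open>Polar coordinates on the upper half plane, with the angle replaced by its cotangent
  \<open>u\<close>; the two quotients are its cosine and sine.\<close>

definition half_plane_map :: "real \<times> real \<Rightarrow> real \<times> real" where
  "half_plane_map = (\<lambda>(u, R). (R * (u / sqrt (1 + u\<^sup>2)), R * (1 / sqrt (1 + u\<^sup>2))))"

text \<open>The absolute Jacobian determinant of \<open>half_plane_map\<close>, restricted to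
  \<open>R > 0\<close>.\<close>

definition half_plane_density :: "real \<times> real \<Rightarrow> real" where
  "half_plane_density = (\<lambda>(u, R). R / (1 + u\<^sup>2) * indicator {0<..} R)"

lemma half_plane_measurable [measurable]:
  "half_plane_map \<in> (lborel \<Otimes>\<^sub>M lborel) \<rightarrow>\<^sub>M (lborel \<Otimes>\<^sub>M lborel)"
  "half_plane_density \<in> borel_measurable (lborel \<Otimes>\<^sub>M lborel)"
  by (simp_all add: half_plane_map_def half_plane_density_def)

lemma half_plane_density_nonneg: "half_plane_density z \<ge> 0"
  by (auto simp: half_plane_density_def indicator_def split: prod.splits)

lemma one_plus_square_pos: "1 + u\<^sup>2 > (0 :: real)"
  by (simp add: add_pos_nonneg)

lemma half_plane_map_norm:
  assumes "R \<ge> 0"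
  shows "sqrt ((fst (half_plane_map (u, R)))\<^sup>2 + (snd (half_plane_map (u, R)))\<^sup>2) = R"
proof -
  have "(fst (half_plane_map (u, R)))\<^sup>2 + (snd (half_plane_map (u, R)))\<^sup>2
      = R\<^sup>2 * (u\<^sup>2 / (1 + u\<^sup>2) + 1 / (1 + u\<^sup>2))"
    using one_plus_square_pos[of u]
    by (simp add: half_plane_map_def power_mult_distrib power_divide distrib_left)
  also have "u\<^sup>2 / (1 + u\<^sup>2) + 1 / (1 + u\<^sup>2) = 1"
    using one_plus_square_pos[of u] by (simp flip: add_divide_distrib)
  finally show ?thesis using assms by simp
qed

text \<open>Integrating over the lines \<open>x = u s\<close> instead of the horizontal lines needs only affine
  substitutions; along each of them the distance \<open>R\<close> from the origin is the parameter.\<close>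

lemma nn_integral_half_plane:
  assumes [measurable]: "f \<in> borel_measurable (lborel \<Otimes>\<^sub>M lborel)"
  shows "(\<integral>\<^sup>+s. \<integral>\<^sup>+x. indicator {0<..} s * f (x, s) \<partial>lborel \<partial>lborel)
    = (\<integral>\<^sup>+u. \<integral>\<^sup>+R. ennreal (half_plane_density (u, R)) * f (half_plane_map (u, R)) \<partial>lborel \<partial>lborel)"
proof -
  have "(\<integral>\<^sup>+s. \<integral>\<^sup>+x. indicator {0<..} s * f (x, s) \<partial>lborel \<partial>lborel)
      = (\<integral>\<^sup>+s. \<integral>\<^sup>+u. ennreal s * indicator {0<..} s * f (s * u, s) \<partial>lborel \<partial>lborel)"
  proof (rule nn_integral_cong)
    fix s :: real
    show "(\<integral>\<^sup>+x. indicator {0<..} s * f (x, s) \<partial>lborel)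
      = (\<integral>\<^sup>+u. ennreal s * indicator {0<..} s * f (s * u, s) \<partial>lborel)"
    proof (cases "s > 0")
      case True
      then show ?thesis
        by (subst nn_integral_real_affine[where t = 0 and c = s])
           (auto simp: nn_integral_cmult)
    qed simp
  qed
  also have "\<dots> = (\<integral>\<^sup>+u. \<integral>\<^sup>+s. ennreal s * indicator {0<..} s * f (s * u, s) \<partial>lborel \<partial>lborel)"
    by (rule lborel_pair.Fubini') measurable
  also have "\<dots> = (\<integral>\<^sup>+u. \<integral>\<^sup>+R. ennreal (half_plane_density (u, R)) * f (half_plane_map (u, R))
      \<partial>lborel \<partial>lborel)"
  proof (rule nn_integral_cong)
    fix u :: real
    define c where "c = 1 / sqrt (1 + u\<^sup>2)"
    have c: "c > 0" using one_plus_square_pos[of u] by (simp add: c_def)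
    have cc: "c * c = 1 / (1 + u\<^sup>2)"
      using one_plus_square_pos[of u] by (simp add: c_def)
    have "(\<integral>\<^sup>+s. ennreal s * indicator {0<..} s * f (s * u, s) \<partial>lborel)
      = ennreal \<bar>c\<bar> * (\<integral>\<^sup>+R. ennreal (0 + c * R) * indicator {0<..} (0 + c * R)
            * f ((0 + c * R) * u, 0 + c * R) \<partial>lborel)"
      by (rule nn_integral_real_affine) (use c in auto)
    also have "\<dots> = (\<integral>\<^sup>+R. ennreal \<bar>c\<bar> * (ennreal (0 + c * R) * indicator {0<..} (0 + c * R)
            * f ((0 + c * R) * u, 0 + c * R)) \<partial>lborel)"
      by (rule nn_integral_cmult[symmetric]) measurable
    also have "\<dots> = (\<integral>\<^sup>+R. ennreal (half_plane_density (u, R)) * f (half_plane_map (u, R)) \<partial>lborel)"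
    proof (rule nn_integral_cong)
      fix R :: real
      show "ennreal \<bar>c\<bar> * (ennreal (0 + c * R) * indicator {0<..} (0 + c * R)
            * f ((0 + c * R) * u, 0 + c * R))
        = ennreal (half_plane_density (u, R)) * f (half_plane_map (u, R))"
      proof (cases "R > 0")
        case True
        have "ennreal c * (ennreal (c * R) * x) = ennreal (R / (1 + u\<^sup>2)) * x" for x
          using c True cc
          by (simp add: mult.assoc[symmetric] flip: ennreal_mult) 
        moreover have "(c * R * u, c * R) = half_plane_map (u, R)"
          by (simp add: half_plane_map_def c_def)
        ultimately show ?thesis
          using c True by (simp add: half_plane_density_def)
      next
        case False
        then have "\<not> c * R > 0" using c by (simp add: zero_less_mult_iff)
        then show ?thesis using False by (simp add: half_plane_density_def)
      qed
    qed
    finally show "(\<integral>\<^sup>+s. ennreal s * indicator {0<..} s * f (s * u, s) \<partial>lborel)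
      = (\<integral>\<^sup>+R. ennreal (half_plane_density (u, R)) * f (half_plane_map (u, R)) \<partial>lborel)" .
  qed
  finally show ?thesis .
qed

text \<open>As an identity of measures, the substitution carries over from nonnegative functions to
  integrability and to Bochner integrals.\<close>

lemma half_plane_measure:
  "density (lborel \<Otimes>\<^sub>M lborel) (\<lambda>z. indicator {0<..} (snd z :: real))
    = distr (density (lborel \<Otimes>\<^sub>M lborel) half_plane_density) (lborel \<Otimes>\<^sub>M lborel) half_plane_map"
    (is "?A = ?B")
proof (rule measure_eqI)
  fix X assume "X \<in> sets ?A"
  then have X [measurable]: "X \<in> sets (lborel \<Otimes>\<^sub>M lborel)" by simp
  have "emeasure ?A X = (\<integral>\<^sup>+z. indicator {0<..} (snd z) * indicator X z \<partial>(lborel \<Otimes>\<^sub>M lborel))"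
    by (rule emeasure_density) measurable
  also have "\<dots> = (\<integral>\<^sup>+s. \<integral>\<^sup>+x. indicator {0<..} s * indicator X (x, s) \<partial>lborel \<partial>lborel)"
    by (subst lborel_pair.nn_integral_snd[symmetric]) auto
  also have "\<dots> = (\<integral>\<^sup>+u. \<integral>\<^sup>+R. ennreal (half_plane_density (u, R))
      * indicator X (half_plane_map (u, R)) \<partial>lborel \<partial>lborel)"
    by (rule nn_integral_half_plane) measurable
  also have "\<dots> = (\<integral>\<^sup>+z. ennreal (half_plane_density z)
      * indicator X (half_plane_map z) \<partial>(lborel \<Otimes>\<^sub>M lborel))"
    by (subst lborel.nn_integral_fst[symmetric]) auto
  also have "\<dots> = (\<integral>\<^sup>+z. indicator X (half_plane_map z)
      \<partial>density (lborel \<Otimes>\<^sub>M lborel) half_plane_density)"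
    by (rule nn_integral_density[symmetric]) measurable
  also have "\<dots> = (\<integral>\<^sup>+z. indicator X z \<partial>?B)"
    by (rule nn_integral_distr[symmetric]) measurable
  also have "\<dots> = emeasure ?B X"
    by (rule nn_integral_indicator) (simp only: sets_distr X)
  finally show "emeasure ?A X = emeasure ?B X" .
qed simp

lemma half_plane_integrable_iff:
  fixes f :: "real \<times> real \<Rightarrow> real"
  assumes [measurable]: "f \<in> borel_measurable (lborel \<Otimes>\<^sub>M lborel)"
  shows "integrable (lborel \<Otimes>\<^sub>M lborel) (\<lambda>z. indicator {0<..} (snd z) * f z)
    \<longleftrightarrow> integrable (lborel \<Otimes>\<^sub>M lborel) (\<lambda>z. half_plane_density z * f (half_plane_map z))"
proof -
  have "integrable (lborel \<Otimes>\<^sub>M lborel) (\<lambda>z. indicator {0<..} (snd z) * f z)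
    \<longleftrightarrow> integrable (density (lborel \<Otimes>\<^sub>M lborel) (\<lambda>z. ennreal (indicator {0<..} (snd z)))) f"
    by (subst integrable_density) auto
  also have "\<dots> \<longleftrightarrow> integrable (lborel \<Otimes>\<^sub>M lborel) (\<lambda>z. half_plane_density z * f (half_plane_map z))"
    unfolding ennreal_indicator half_plane_measure
    by (simp add: integrable_distr_eq integrable_density half_plane_density_nonneg)
  finally show ?thesis .
qed

lemma half_plane_integral:
  fixes f :: "real \<times> real \<Rightarrow> real"
  assumes [measurable]: "f \<in> borel_measurable (lborel \<Otimes>\<^sub>M lborel)"
  shows "(\<integral>z. indicator {0<..} (snd z) * f z \<partial>(lborel \<Otimes>\<^sub>M lborel))
    = (\<integral>z. half_plane_density z * f (half_plane_map z) \<partial>(lborel \<Otimes>\<^sub>M lborel))"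
proof -
  have "(\<integral>z. indicator {0<..} (snd z) * f z \<partial>(lborel \<Otimes>\<^sub>M lborel))
    = integral\<^sup>L (density (lborel \<Otimes>\<^sub>M lborel) (\<lambda>z. ennreal (indicator {0<..} (snd z)))) f"
    by (subst integral_density) auto
  also have "\<dots> = (\<integral>z. half_plane_density z * f (half_plane_map z) \<partial>(lborel \<Otimes>\<^sub>M lborel))"
    unfolding ennreal_indicator half_plane_measure
    by (simp add: integral_distr integral_density half_plane_density_nonneg)
  finally show ?thesis .
qed

text \<open>Of the Jacobian, the factor \<open>R\<close> goes into the separation hypothesis and
  \<open>1 / (1 + u^2)\<close> stays with \<open>g\<close>; Fubini then gives a product of two
  integrals.\<close>

lemma half_plane_polar:
  fixes f :: "real \<times> real \<Rightarrow> real" and g h :: "real \<Rightarrow> real"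
  assumes [measurable]: "f \<in> borel_measurable (lborel \<Otimes>\<^sub>M lborel)"
    and f: "\<And>u R. R > 0 \<Longrightarrow> R * f (half_plane_map (u, R)) = g u * h R"
    and g: "integrable lborel (\<lambda>u. g u / (1 + u\<^sup>2))"
    and h: "integrable lborel (\<lambda>R. indicator {0<..} R * h R)"
  shows "integrable (lborel \<Otimes>\<^sub>M lborel) (\<lambda>z. indicator {0<..} (snd z) * f z)"
    and "(\<integral>z. indicator {0<..} (snd z) * f z \<partial>(lborel \<Otimes>\<^sub>M lborel))
      = (\<integral>u. g u / (1 + u\<^sup>2) \<partial>lborel) * (\<integral>R. indicator {0<..} R * h R \<partial>lborel)"
proof -
  define G where "G u = g u / (1 + u\<^sup>2)" for u
  define H where "H R = indicator {0<..} R * h R" for R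
  have G: "integrable lborel G" and H: "integrable lborel H"
    using g h by (simp_all add: G_def [abs_def] H_def [abs_def])
  note [measurable] = borel_measurable_integrable[OF G] borel_measurable_integrable[OF H]
  have eq: "half_plane_density z * f (half_plane_map z) = G (fst z) * H (snd z)" for z
    using f[of "snd z" "fst z"]
    by (cases z) (auto simp: half_plane_density_def indicator_def G_def H_def field_simps)
  have int: "integrable (lborel \<Otimes>\<^sub>M lborel) (\<lambda>z. G (fst z) * H (snd z))"
  proof (rule lborel_pair.Fubini_integrable)
    have "(\<lambda>x. LINT y|lborel. norm (G (fst (x, y)) * H (snd (x, y))))
        = (\<lambda>x. norm (G x) * (LINT y|lborel. norm (H y)))"
      by (simp only: norm_mult fst_conv snd_conv integral_mult_right_zero)
    then show "integrable lborel (\<lambda>x. LINT y|lborel. norm (G (fst (x, y)) * H (snd (x, y))))"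
      using G by (simp only:) (intro integrable_mult_left integrable_norm)
  qed (use H in auto)
  then show "integrable (lborel \<Otimes>\<^sub>M lborel) (\<lambda>z. indicator {0<..} (snd z) * f z)"
    by (simp only: half_plane_integrable_iff[OF assms(1)] eq)
  have "(\<integral>z. indicator {0<..} (snd z) * f z \<partial>(lborel \<Otimes>\<^sub>M lborel))
      = (\<integral>z. G (fst z) * H (snd z) \<partial>(lborel \<Otimes>\<^sub>M lborel))"
    by (simp only: half_plane_integral[OF assms(1)] eq)
  also have "\<dots> = (\<integral>u. \<integral>R. G u * H R \<partial>lborel \<partial>lborel)"
    using lborel_pair.integral_fst'[OF int] by simp
  also have "\<dots> = (\<integral>u. G u \<partial>lborel) * (\<integral>R. H R \<partial>lborel)"
    by simp
  finally show "(\<integral>z. indicator {0<..} (snd z) * f z \<partial>(lborel \<Otimes>\<^sub>M lborel))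
      = (\<integral>u. g u / (1 + u\<^sup>2) \<partial>lborel) * (\<integral>R. indicator {0<..} R * h R \<partial>lborel)"
    by (simp only: G_def H_def)
qed

lemma integrable_inverse_one_plus_square: "integrable lborel (\<lambda>u::real. 1 / (1 + u\<^sup>2))"
  using integrable_inverse_1_plus_square
  by (simp add: set_integrable_def einterval_def inverse_eq_divide)

section \<open>Radial integrals over product spaces\<close>

interpretation lborel_PiM: product_sigma_finite "\<lambda>_::nat. lborel :: real measure" ..

lemma L2_set_measurable [measurable]:
  assumes "I \<subseteq> J" 
  shows "(\<lambda>x. L2_set x I) \<in> borel_measurable (PiM J (\<lambda>_. lborel :: real measure))"
proof (cases "finite I")
  case True
  have [measurable]: "(\<lambda>x. x i) \<in> borel_measurable (PiM J (\<lambda>_. lborel :: real measure))" if "i \<in> I" for i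
    using measurable_component_singleton[of i J "\<lambda>_. lborel :: real measure"] that assms by auto
  show ?thesis unfolding L2_set_def by measurable
qed simp

lemma atLeastAtMost_eq_insert: "k < d \<Longrightarrow> {k..d::nat} = insert k {Suc k..d}"
  by auto

lemma L2_set_fun_upd:
  assumes "k < d"
  shows "L2_set (x(k := y)) {k..d::nat} = sqrt (y\<^sup>2 + (L2_set x {Suc k..d})\<^sup>2)"
proof -
  have "L2_set (x(k := y)) {Suc k..d} = L2_set x {Suc k..d}"
    by (rule L2_set_cong) auto
  then show ?thesis
    unfolding atLeastAtMost_eq_insert[OF assms] by simp
qed

lemma nn_integral_radial_1:
  fixes \<psi> :: "real \<Rightarrow> ennreal"
  assumes [measurable]: "\<psi> \<in> borel_measurable borel"
  shows "(\<integral>\<^sup>+x. \<psi> \<bar>x\<bar> \<partial>lborel) = 2 * (\<integral>\<^sup>+R. \<psi> R * indicator {0<..} R \<partial>lborel)"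
proof -
  have "(\<integral>\<^sup>+x. \<psi> \<bar>x\<bar> \<partial>lborel)
      = (\<integral>\<^sup>+x. \<psi> x * indicator {0<..} x + \<psi> (- x) * indicator {0<..} (- x) \<partial>lborel)"
    by (rule nn_integral_cong_AE)
       (use AE_lborel_singleton[of 0] in \<open>eventually_elim, auto simp: indicator_def\<close>)
  also have "\<dots> = (\<integral>\<^sup>+x. \<psi> x * indicator {0<..} x \<partial>lborel)
      + (\<integral>\<^sup>+x. \<psi> (- x) * indicator {0<..} (- x) \<partial>lborel)"
    by (rule nn_integral_add) measurable
  also have "(\<integral>\<^sup>+x. \<psi> (- x) * indicator {0<..} (- x) \<partial>lborel)
      = (\<integral>\<^sup>+x. \<psi> x * indicator {0<..} x \<partial>lborel)"
    by (subst (2) nn_integral_real_affine[where t = 0 and c = "-1"]) auto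
  finally show ?thesis by (simp add: mult_2)
qed

text \<open>Splitting off \<open>x k\<close> leaves a radial function of the remaining coordinates,
  and polar coordinates in the half plane recombine the two radii. Every coordinate contributes a
  finite angular integral to \<open>C\<close>, the surface measure of the unit sphere.\<close>

lemma nn_integral_radial:
  assumes "k \<le> d"
  shows "\<exists>C<\<infinity>. \<forall>\<psi>\<in>borel_measurable borel.
    (\<integral>\<^sup>+x. \<psi> (L2_set x {k..d}) \<partial>PiM {k..d} (\<lambda>_. lborel))
      = C * (\<integral>\<^sup>+R. \<psi> R * ennreal (R ^ (d - k)) * indicator {0<..} R \<partial>lborel)"
  using assms
proof (induction k rule: inc_induct)
  case base
  have "(\<integral>\<^sup>+x. \<psi> (L2_set x {d..d}) \<partial>PiM {d..d} (\<lambda>_. lborel))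
      = 2 * (\<integral>\<^sup>+R. \<psi> R * ennreal (R ^ (d - d)) * indicator {0<..} R \<partial>lborel)"
    if [measurable]: "\<psi> \<in> borel_measurable borel" for \<psi> :: "real \<Rightarrow> ennreal"
    using lborel_PiM.product_nn_integral_singleton[of "\<lambda>x. \<psi> \<bar>x\<bar>" d] nn_integral_radial_1[OF that]
    by simp
  then show ?case by (intro exI[of _ 2]) auto
next
  case (step k)
  then obtain C where C: "C < \<infinity>" and IH: "\<And>\<psi>. \<psi> \<in> borel_measurable borel \<Longrightarrow>
    (\<integral>\<^sup>+x. \<psi> (L2_set x {Suc k..d}) \<partial>PiM {Suc k..d} (\<lambda>_. lborel))
      = C * (\<integral>\<^sup>+R. \<psi> R * ennreal (R ^ (d - Suc k)) * indicator {0<..} R \<partial>lborel)"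
    by blast
  define n where "n = d - Suc k"
  have dk: "d - k = Suc n" using step.hyps by (simp add: n_def)
  \<comment> \<open>The factor \<open>s ^ n\<close>, with \<open>s\<close> the remaining radius,
    contributes \<open>n\<close> powers of the sine; the rest is the density of \<open>u\<close>.
    The bound by \<open>1 / (1 + u^2)\<close> makes the integral finite.\<close>
  define g where "g u = (1 / sqrt (1 + u\<^sup>2)) ^ n * (1 / (1 + u\<^sup>2))" for u :: real
  have gpos: "g u \<ge> 0" for u by (simp add: g_def)
  define D where "D = (\<integral>\<^sup>+u. ennreal (g u) \<partial>lborel)"
  have "D \<le> (\<integral>\<^sup>+u. ennreal (1 / (1 + u\<^sup>2)) \<partial>lborel)"
    unfolding D_def g_def
    by (intro nn_integral_mono ennreal_leI mult_left_le_one_le power_le_one) 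
       (auto simp: one_plus_square_pos less_imp_le)
  also have "\<dots> < \<infinity>"
    using integrable_inverse_one_plus_square
    by (subst (asm) integrable_iff_bounded) (auto simp: one_plus_square_pos less_imp_le)
  finally have D: "D < \<infinity>" .
  show ?case
  proof (intro exI[of _ "C * D"] conjI ballI)
    show "C * D < \<infinity>" using C D by (simp add: ennreal_mult_less_top)
    fix \<psi> :: "real \<Rightarrow> ennreal" assume [measurable]: "\<psi> \<in> borel_measurable borel"
    have "(\<integral>\<^sup>+x. \<psi> (L2_set x {k..d}) \<partial>PiM {k..d} (\<lambda>_. lborel))
      = (\<integral>\<^sup>+y. \<integral>\<^sup>+x. \<psi> (L2_set (x(k := y)) {k..d}) \<partial>PiM {Suc k..d} (\<lambda>_. lborel) \<partial>lborel)"
      using lborel_PiM.product_nn_integral_insert_rev[of "{Suc k..d}" k "\<lambda>x. \<psi> (L2_set x {k..d})"]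
        step.hyps
      by (simp flip: atLeastAtMost_eq_insert)
    also have "\<dots> = (\<integral>\<^sup>+y. \<integral>\<^sup>+x. \<psi> (sqrt (y\<^sup>2 + (L2_set x {Suc k..d})\<^sup>2))
        \<partial>PiM {Suc k..d} (\<lambda>_. lborel) \<partial>lborel)"
      using step.hyps by (simp add: L2_set_fun_upd)
    also have "\<dots> = (\<integral>\<^sup>+y. C * (\<integral>\<^sup>+s. \<psi> (sqrt (y\<^sup>2 + s\<^sup>2)) * ennreal (s ^ n) * indicator {0<..} s
        \<partial>lborel) \<partial>lborel)"
      by (subst IH) (auto simp: n_def)
    also have "\<dots> = C * (\<integral>\<^sup>+y. \<integral>\<^sup>+s. \<psi> (sqrt (y\<^sup>2 + s\<^sup>2)) * ennreal (s ^ n) * indicator {0<..} s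
        \<partial>lborel \<partial>lborel)"
      by (rule nn_integral_cmult) measurable
    also have "(\<integral>\<^sup>+y. \<integral>\<^sup>+s. \<psi> (sqrt (y\<^sup>2 + s\<^sup>2)) * ennreal (s ^ n) * indicator {0<..} s
        \<partial>lborel \<partial>lborel)
      = (\<integral>\<^sup>+s. \<integral>\<^sup>+y. \<psi> (sqrt (y\<^sup>2 + s\<^sup>2)) * ennreal (s ^ n) * indicator {0<..} s
        \<partial>lborel \<partial>lborel)"
      by (rule lborel_pair.Fubini') measurable
    also have "\<dots> = (\<integral>\<^sup>+s. \<integral>\<^sup>+y. indicator {0<..} s *
        (\<lambda>z. \<psi> (sqrt ((fst z)\<^sup>2 + (snd z)\<^sup>2)) * ennreal ((snd z) ^ n)) (y, s) \<partial>lborel \<partial>lborel)"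
      by (simp add: mult_ac)
    also have "\<dots> = (\<integral>\<^sup>+u. \<integral>\<^sup>+R. ennreal (half_plane_density (u, R)) *
        (\<lambda>z. \<psi> (sqrt ((fst z)\<^sup>2 + (snd z)\<^sup>2)) * ennreal ((snd z) ^ n)) (half_plane_map (u, R))
          \<partial>lborel \<partial>lborel)"
      by (rule nn_integral_half_plane) measurable
    also have "\<dots> = (\<integral>\<^sup>+u. \<integral>\<^sup>+R. ennreal (g u) * (\<psi> R * ennreal (R ^ (d - k)) * indicator {0<..} R)
          \<partial>lborel \<partial>lborel)"
    proof (intro nn_integral_cong)
      fix u R :: real
      show "ennreal (half_plane_density (u, R)) *
        (\<lambda>z. \<psi> (sqrt ((fst z)\<^sup>2 + (snd z)\<^sup>2)) * ennreal ((snd z) ^ n)) (half_plane_map (u, R))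
        = ennreal (g u) * (\<psi> R * ennreal (R ^ (d - k)) * indicator {0<..} R)"
      proof (cases "R > 0")
        case True
        have "sqrt ((fst (half_plane_map (u, R)))\<^sup>2 + (snd (half_plane_map (u, R)))\<^sup>2) = R"
          using True by (intro half_plane_map_norm) simp
        moreover have "ennreal (half_plane_density (u, R)) * ennreal (snd (half_plane_map (u, R)) ^ n)
          = ennreal (g u) * ennreal (R ^ (d - k))"
          using True unfolding dk
          by (simp add: half_plane_density_def half_plane_map_def g_def power_mult_distrib
              power_divide mult_ac flip: ennreal_mult)
        ultimately show ?thesis
          using True by (simp add: mult_ac)
      qed (simp add: half_plane_density_def)
    qed
    also have "\<dots> = (\<integral>\<^sup>+u. ennreal (g u) * (\<integral>\<^sup>+R. \<psi> R * ennreal (R ^ (d - k)) * indicator {0<..} R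
          \<partial>lborel) \<partial>lborel)"
      by (intro nn_integral_cong nn_integral_cmult) measurable
    also have "\<dots> = D * (\<integral>\<^sup>+R. \<psi> R * ennreal (R ^ (d - k)) * indicator {0<..} R \<partial>lborel)"
      unfolding D_def by (rule nn_integral_multc) (simp add: g_def)
    finally show "(\<integral>\<^sup>+x. \<psi> (L2_set x {k..d}) \<partial>PiM {k..d} (\<lambda>_. lborel))
      = C * D * (\<integral>\<^sup>+R. \<psi> R * ennreal (R ^ (d - k)) * indicator {0<..} R \<partial>lborel)"
      by (simp add: mult.assoc)
  qed
qed

section \<open>Radial integration of homogenized products\<close>

text \<open>This is \<open>R ^ n * poly q (x / R)\<close> for \<open>degree q \<le> n\<close>,
  written without division so that it makes sense at \<open>R = 0\<close>.\<close>

definition homogenize :: "real poly \<Rightarrow> nat \<Rightarrow> real \<Rightarrow> real \<Rightarrow> real" where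
  "homogenize q n x R = (\<Sum>i\<le>n. coeff q i * x ^ i * R ^ (n - i))"

lemma homogenize_mult:
  assumes "degree q \<le> n"
  shows "homogenize q n (R * t) R = R ^ n * poly q t"
proof -
  have "poly q t = (\<Sum>i\<le>n. coeff q i * t ^ i)"
    unfolding poly_altdef using assms by (intro sum.mono_neutral_left) (auto simp: coeff_eq_0)
  moreover have "coeff q i * (R * t) ^ i * R ^ (n - i) = R ^ n * (coeff q i * t ^ i)" if "i \<le> n" for i
    using power_add[of R i "n - i"] that by (simp add: power_mult_distrib)
  ultimately show ?thesis
    unfolding homogenize_def by (simp only: sum_distrib_left) (intro sum.cong refl, simp)
qed

lemma homogenize_bound: "\<exists>B\<ge>0. \<forall>x R. \<bar>x\<bar> \<le> R \<longrightarrow> \<bar>homogenize q n x R\<bar> \<le> B * R ^ n"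
proof (intro exI[of _ "\<Sum>i\<le>n. \<bar>coeff q i\<bar>"] conjI allI impI)
  fix x R :: real assume x: "\<bar>x\<bar> \<le> R"
  have "\<bar>coeff q i * x ^ i * R ^ (n - i)\<bar> \<le> \<bar>coeff q i\<bar> * R ^ n" if "i \<le> n" for i
  proof -
    have "\<bar>x\<bar> ^ i * R ^ (n - i) \<le> R ^ i * R ^ (n - i)"
      using x by (intro mult_right_mono power_mono) auto
    also have "\<dots> = R ^ n" using that by (simp flip: power_add)
    finally show ?thesis
      using x by (simp add: abs_mult power_abs mult.assoc mult_left_mono)
  qed
  then show "\<bar>homogenize q n x R\<bar> \<le> (\<Sum>i\<le>n. \<bar>coeff q i\<bar>) * R ^ n"
    unfolding homogenize_def sum_distrib_right
    by (intro order.trans[OF sum_abs] sum_mono) auto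
qed (simp add: sum_nonneg)

text \<open>The integral over one polar angle in the cotangent variable: \<open>q\<close> and the
  power \<open>a\<close> take the cosine, \<open>n\<close> is the exponent of the sine.\<close>

definition angular_factor :: "real poly \<Rightarrow> nat \<Rightarrow> nat \<Rightarrow> real" where
  "angular_factor q a n = (\<integral>u. poly q (u / sqrt (1 + u\<^sup>2)) * (u / sqrt (1 + u\<^sup>2)) ^ a
      * (1 / sqrt (1 + u\<^sup>2)) ^ n / (1 + u\<^sup>2) \<partial>lborel)"

lemma integrable_angular_factor:
  "integrable lborel (\<lambda>u. poly q (u / sqrt (1 + u\<^sup>2)) * (u / sqrt (1 + u\<^sup>2)) ^ a
      * (1 / sqrt (1 + u\<^sup>2)) ^ n / (1 + u\<^sup>2))"
proof -
  have "compact (poly q ` {-1..1})"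
    by (intro compact_continuous_image continuous_on_poly continuous_on_id compact_Icc)
  then obtain B where B: "\<And>t. t \<in> {-1..1} \<Longrightarrow> \<bar>poly q t\<bar> \<le> B"
    by (meson bounded_real compact_imp_bounded image_eqI)
  show ?thesis
  proof (rule Bochner_Integration.integrable_bound)
    show "integrable lborel (\<lambda>u. B * (1 / (1 + u\<^sup>2)))"
      using integrable_inverse_one_plus_square by (rule integrable_mult_right)
    show "AE u in lborel. norm (poly q (u / sqrt (1 + u\<^sup>2)) * (u / sqrt (1 + u\<^sup>2)) ^ a
      * (1 / sqrt (1 + u\<^sup>2)) ^ n / (1 + u\<^sup>2)) \<le> norm (B * (1 / (1 + u\<^sup>2)))"
    proof (rule AE_I2)
      fix u :: real
      have pos: "1 + u\<^sup>2 > 0" by (rule one_plus_square_pos)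
      have "\<bar>u\<bar> \<le> sqrt (1 + u\<^sup>2)" by (rule real_le_rsqrt) simp
      then have t: "\<bar>u / sqrt (1 + u\<^sup>2)\<bar> \<le> 1" using pos by simp
      have t': "u / sqrt (1 + u\<^sup>2) \<in> {-1..1}"
        using t unfolding abs_le_iff by auto
      have c: "\<bar>1 / sqrt (1 + u\<^sup>2)\<bar> \<le> 1" using pos by simp
      have "\<bar>poly q (u / sqrt (1 + u\<^sup>2))\<bar> * \<bar>u / sqrt (1 + u\<^sup>2)\<bar> ^ a
          * \<bar>1 / sqrt (1 + u\<^sup>2)\<bar> ^ n \<le> B * 1 * 1"
        using t c B[of 0] B[OF t'] by (intro mult_mono power_le_one) auto
      then have "\<bar>poly q (u / sqrt (1 + u\<^sup>2)) * (u / sqrt (1 + u\<^sup>2)) ^ a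
          * (1 / sqrt (1 + u\<^sup>2)) ^ n\<bar> \<le> B"
        by (simp only: abs_mult power_abs)
      from divide_right_mono[OF this, of "1 + u\<^sup>2"] pos B[of 0]
      show "norm (poly q (u / sqrt (1 + u\<^sup>2)) * (u / sqrt (1 + u\<^sup>2)) ^ a
        * (1 / sqrt (1 + u\<^sup>2)) ^ n / (1 + u\<^sup>2)) \<le> norm (B * (1 / (1 + u\<^sup>2)))"
        by (simp only: real_norm_def abs_divide abs_mult[of B]) simp
    qed
  qed measurable
qed

section \<open>Integrating out the coordinates one at a time\<close>

definition harmonic_tail :: "nat \<Rightarrow> (nat \<Rightarrow> nat) \<Rightarrow> (nat \<Rightarrow> real poly) \<Rightarrow> nat \<Rightarrow> (nat \<Rightarrow> real) \<Rightarrow> real"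
  where "harmonic_tail d m Q k x =
    (\<Prod>i=k..<d. homogenize (Q i) (m i) (x i) (L2_set x {i..d})) * x d ^ m d"

definition tail_integrand ::
  "nat \<Rightarrow> (nat \<Rightarrow> nat) \<Rightarrow> (nat \<Rightarrow> real poly) \<Rightarrow> (nat \<Rightarrow> nat) \<Rightarrow> nat \<Rightarrow> (nat \<Rightarrow> real) \<Rightarrow> real"
  where "tail_integrand d m Q a k x = harmonic_tail d m Q k x * (\<Prod>i=k..d. x i ^ a i)"

text \<open>The leading factor comes from \<open>x d\<close>, which runs over both half-lines. The
  exponent of the sine at index \<open>i\<close> is the degree of homogeneity of the later
  coordinates plus \<open>d - Suc i\<close> from their radial measure.\<close>

definition tail_const ::
  "nat \<Rightarrow> (nat \<Rightarrow> nat) \<Rightarrow> (nat \<Rightarrow> real poly) \<Rightarrow> (nat \<Rightarrow> nat) \<Rightarrow> nat \<Rightarrow> real"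
  where "tail_const d m Q a k = (1 + (-1) ^ (m d + a d)) *
    (\<Prod>i=k..<d. angular_factor (Q i) (a i) ((\<Sum>l=Suc i..d. m l + a l) + (d - Suc i)))"

lemma tail_const_Suc:
  "k < d \<Longrightarrow> tail_const d m Q a k = tail_const d m Q a (Suc k)
     * angular_factor (Q k) (a k) ((\<Sum>l=Suc k..d. m l + a l) + (d - Suc k))"
  by (simp add: tail_const_def prod.atLeast_Suc_lessThan mult_ac)

lemma component_measurable:
  "i \<in> J \<Longrightarrow> (\<lambda>x. x i) \<in> borel_measurable (PiM J (\<lambda>_. lborel :: real measure))"
  using measurable_component_singleton[of i J "\<lambda>_. lborel :: real measure"] by simp

lemma harmonic_tail_measurable:
  assumes "k \<le> d" "{k..d} \<subseteq> J"
  shows "harmonic_tail d m Q k \<in> borel_measurable (PiM J (\<lambda>_. lborel :: real measure))"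
  unfolding harmonic_tail_def[abs_def] homogenize_def
  by (intro borel_measurable_times borel_measurable_prod borel_measurable_sum
      borel_measurable_power borel_measurable_const L2_set_measurable component_measurable)
    (use assms in fastforce)+

lemma tail_integrand_measurable:
  assumes "k \<le> d" "{k..d} \<subseteq> J"
  shows "tail_integrand d m Q a k \<in> borel_measurable (PiM J (\<lambda>_. lborel :: real measure))"
  unfolding tail_integrand_def[abs_def]
  by (intro borel_measurable_times borel_measurable_prod borel_measurable_power
      harmonic_tail_measurable component_measurable)
    (use assms in fastforce)+

lemma abs_component_le_L2_set: "finite A \<Longrightarrow> i \<in> A \<Longrightarrow> \<bar>x i\<bar> \<le> L2_set x A"
  unfolding L2_set_def by (intro real_le_rsqrt) (auto intro: member_le_sum[of i A "\<lambda>i. (x i)\<^sup>2"])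

lemma L2_set_subset: "finite B \<Longrightarrow> A \<subseteq> B \<Longrightarrow> L2_set x A \<le> L2_set x B"
  unfolding L2_set_def by (intro real_sqrt_le_mono sum_mono2) auto

text \<open>Each factor is bounded by a power of the full norm, and the exponents add up to the
  degree of homogeneity. This reduces integrability to a radial integral.\<close>

lemma tail_integrand_bound:
  assumes "k \<le> d"
  shows "\<exists>B\<ge>0. \<forall>x. \<bar>tail_integrand d m Q a k x\<bar> \<le> B * L2_set x {k..d} ^ (\<Sum>i=k..d. m i + a i)"
proof -
  obtain B where B: "\<And>i. B i \<ge> 0"
      "\<And>i x R. \<bar>x\<bar> \<le> R \<Longrightarrow> \<bar>homogenize (Q i) (m i) x R\<bar> \<le> B i * R ^ m i"
    using choice[OF allI, of "\<lambda>i B. B \<ge> 0 \<and> (\<forall>x R. \<bar>x\<bar> \<le> R \<longrightarrow>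
      \<bar>homogenize (Q i) (m i) x R\<bar> \<le> B * R ^ m i)"] homogenize_bound by blast
  have "\<bar>tail_integrand d m Q a k x\<bar> \<le> prod B {k..<d} * L2_set x {k..d} ^ (\<Sum>i=k..d. m i + a i)" for x
  proof -
    define R where "R = L2_set x {k..d}"
    have R: "R \<ge> 0" by (simp add: R_def)
    have x: "\<bar>x i\<bar> \<le> R" if "i \<in> {k..d}" for i
      unfolding R_def using that by (intro abs_component_le_L2_set) auto
    have "\<bar>homogenize (Q i) (m i) (x i) (L2_set x {i..d})\<bar> \<le> B i * R ^ m i" if "i \<in> {k..<d}" for i
    proof -
      have "\<bar>homogenize (Q i) (m i) (x i) (L2_set x {i..d})\<bar> \<le> B i * L2_set x {i..d} ^ m i"
        using that by (intro B abs_component_le_L2_set) auto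
      also have "\<dots> \<le> B i * R ^ m i"
        using that B(1) unfolding R_def
        by (intro mult_left_mono power_mono L2_set_subset) auto
      finally show ?thesis .
    qed
    then have "(\<Prod>i=k..<d. \<bar>homogenize (Q i) (m i) (x i) (L2_set x {i..d})\<bar>)
        \<le> (\<Prod>i=k..<d. B i * R ^ m i)"
      by (intro prod_mono) auto
    moreover have "\<bar>x d\<bar> ^ m d \<le> R ^ m d"
      using x assms by (intro power_mono) auto
    moreover have "(\<Prod>i=k..d. \<bar>x i\<bar> ^ a i) \<le> (\<Prod>i=k..d. R ^ a i)"
      using x by (intro prod_mono) (auto intro: power_mono)
    ultimately have "\<bar>tail_integrand d m Q a k x\<bar>
      \<le> (\<Prod>i=k..<d. B i * R ^ m i) * R ^ m d * (\<Prod>i=k..d. R ^ a i)"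
      unfolding tail_integrand_def harmonic_tail_def abs_mult abs_prod power_abs
      using R B(1) by (intro mult_mono) (auto intro!: prod_nonneg mult_nonneg_nonneg)
    also have "\<dots> = prod B {k..<d} * R ^ (\<Sum>i=k..d. m i + a i)"
      using assms
      by (simp add: prod.distrib sum.distrib power_add mult.assoc flip: power_sum)
         (simp add: sum.last_plus power_add atLeastLessThanSuc_atLeastAtMost[symmetric])
    finally show ?thesis by (simp add: R_def)
  qed
  then show ?thesis using B(1) by (intro exI[of _ "prod B {k..<d}"]) (auto intro: prod_nonneg)
qed

lemma tail_integrable:
  assumes "k \<le> d" and [measurable]: "\<phi> \<in> borel_measurable borel"
    and int: "integrable lborel
      (\<lambda>R. indicator {0<..} R * (\<phi> R * R ^ ((\<Sum>i=k..d. m i + a i) + (d - k))))"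
  shows "integrable (PiM {k..d} (\<lambda>_. lborel)) (\<lambda>x. \<phi> (L2_set x {k..d}) * tail_integrand d m Q a k x)"
proof -
  let ?M = "PiM {k..d} (\<lambda>_. lborel :: real measure)"
  define D where "D = (\<Sum>i=k..d. m i + a i)"
  obtain B where B: "B \<ge> 0" "\<And>x. \<bar>tail_integrand d m Q a k x\<bar> \<le> B * L2_set x {k..d} ^ D"
    using tail_integrand_bound[OF assms(1)] unfolding D_def by blast
  obtain C where C: "C < \<infinity>" "\<And>\<psi>. \<psi> \<in> borel_measurable borel \<Longrightarrow>
      (\<integral>\<^sup>+x. \<psi> (L2_set x {k..d}) \<partial>?M)
        = C * (\<integral>\<^sup>+R. \<psi> R * ennreal (R ^ (d - k)) * indicator {0<..} R \<partial>lborel)"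
    using nn_integral_radial[OF assms(1)] by blast
  have [measurable]: "tail_integrand d m Q a k \<in> borel_measurable ?M"
      "(\<lambda>x. L2_set x {k..d}) \<in> borel_measurable ?M"
    using assms(1) by (auto intro: L2_set_measurable tail_integrand_measurable)
  show ?thesis
  proof (rule integrableI_bounded)
    have "(\<integral>\<^sup>+x. norm (\<phi> (L2_set x {k..d}) * tail_integrand d m Q a k x) \<partial>?M)
      \<le> (\<integral>\<^sup>+x. (\<lambda>R. ennreal (\<bar>\<phi> R\<bar> * (B * R ^ D))) (L2_set x {k..d}) \<partial>?M)"
      using B(2) by (intro nn_integral_mono ennreal_leI) (auto simp: abs_mult intro: mult_left_mono)
    also have "\<dots> = C * (\<integral>\<^sup>+R. ennreal (\<bar>\<phi> R\<bar> * (B * R ^ D)) * ennreal (R ^ (d - k))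
        * indicator {0<..} R \<partial>lborel)"
      by (rule C(2)) measurable
    also have "(\<integral>\<^sup>+R. ennreal (\<bar>\<phi> R\<bar> * (B * R ^ D)) * ennreal (R ^ (d - k)) * indicator {0<..} R \<partial>lborel)
       = (\<integral>\<^sup>+R. ennreal (norm (B * (indicator {0<..} R * (\<phi> R * R ^ (D + (d - k)))))) \<partial>lborel)"
      using B(1)
      by (intro nn_integral_cong)
         (auto simp: indicator_def abs_mult power_add mult_ac simp flip: ennreal_mult)
    also have "C * \<dots> < \<infinity>"
      using C(1) integrable_mult_right[OF int[folded D_def], of B]
      by (auto simp only: integrable_iff_bounded ennreal_mult_less_top infinity_ennreal_def)
    finally show "(\<integral>\<^sup>+x. norm (\<phi> (L2_set x {k..d}) * tail_integrand d m Q a k x) \<partial>?M) < \<infinity>" .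
  qed measurable
qed

text \<open>The negative half-line is reflected; the parity of \<open>p\<close> decides whether the
  two halves add up or cancel.\<close>

lemma integral_radial_1:
  fixes \<phi> :: "real \<Rightarrow> real"
  assumes [measurable]: "\<phi> \<in> borel_measurable borel"
    and int: "integrable lborel (\<lambda>R. indicator {0<..} R * (\<phi> R * R ^ p))"
  shows "(\<integral>x. \<phi> \<bar>x\<bar> * x ^ p \<partial>lborel)
    = (1 + (-1) ^ p) * (\<integral>R. indicator {0<..} R * (\<phi> R * R ^ p) \<partial>lborel)"
proof -
  let ?h = "\<lambda>R. indicator {0<..} R * (\<phi> R * R ^ p)"
  have int': "integrable lborel (\<lambda>x. ?h (- x))"
    using lborel_integrable_real_affine[OF int, of "-1" 0] by simp
  have "(\<integral>x. \<phi> \<bar>x\<bar> * x ^ p \<partial>lborel) = (\<integral>x. ?h x + (-1) ^ p * ?h (- x) \<partial>lborel)"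
  proof (rule integral_cong_AE)
    show "AE x in lborel. \<phi> \<bar>x\<bar> * x ^ p = ?h x + (-1) ^ p * ?h (- x)"
      using AE_lborel_singleton[of 0]
    proof eventually_elim
      case (elim x)
      have "(-1) ^ p * (- x) ^ p = x ^ p" by (simp flip: power_mult_distrib)
      then show ?case using elim by (auto simp: indicator_def)
    qed
  qed measurable
  also have "\<dots> = (\<integral>x. ?h x \<partial>lborel) + (-1) ^ p * (\<integral>x. ?h (- x) \<partial>lborel)"
    using int int' by (subst Bochner_Integration.integral_add) auto
  also have "(\<integral>x. ?h (- x) \<partial>lborel) = (\<integral>x. ?h x \<partial>lborel)"
    using lborel_integral_real_affine[of "-1" ?h 0] by simp
  finally show ?thesis by (simp add: algebra_simps)
qed

text \<open>Fubini with the new coordinate outermost. Measurability of the inner integral is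
  recorded for comparing it almost everywhere in \<open>tail_integral\<close>.\<close>

lemma product_integral_insert_rev:
  fixes f :: "(nat \<Rightarrow> real) \<Rightarrow> real"
  assumes I: "finite I" "i \<notin> I" and f: "integrable (PiM (insert i I) (\<lambda>_. lborel)) f"
  shows "integral\<^sup>L (PiM (insert i I) (\<lambda>_. lborel)) f
    = (\<integral>y. \<integral>x. f (x(i := y)) \<partial>PiM I (\<lambda>_. lborel) \<partial>lborel)"
    and "(\<lambda>y. \<integral>x. f (x(i := y)) \<partial>PiM I (\<lambda>_. lborel)) \<in> borel_measurable lborel"
proof -
  interpret I: sigma_finite_measure "PiM I (\<lambda>_. lborel :: real measure)"
    using I(1) by (rule lborel_PiM.sigma_finite)
  note [measurable] = borel_measurable_integrable[OF f]
  show meas [measurable]: "(\<lambda>y. \<integral>x. f (x(i := y)) \<partial>PiM I (\<lambda>_. lborel)) \<in> borel_measurable lborel"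
    by (rule I.borel_measurable_lebesgue_integral) measurable
  have "integral\<^sup>L (PiM (insert i I) (\<lambda>_. lborel)) f
     = (\<integral>z. (\<integral>x. f (merge {i} I (z, x)) \<partial>PiM I (\<lambda>_. lborel)) \<partial>PiM {i} (\<lambda>_. lborel))"
    using lborel_PiM.product_integral_fold[of "{i}" I f] I f by simp
  also have "\<dots> = (\<integral>z. (\<integral>x. f (x(i := z i)) \<partial>PiM I (\<lambda>_. lborel)) \<partial>PiM {i} (\<lambda>_. lborel))"
  proof (intro Bochner_Integration.integral_cong refl arg_cong[where f = f])
    fix z x :: "nat \<Rightarrow> real"
    assume "z \<in> space (PiM {i} (\<lambda>_. lborel :: real measure))"
      and "x \<in> space (PiM I (\<lambda>_. lborel :: real measure))"
    then show "merge {i} I (z, x) = x(i := z i)"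
      using I by (auto simp: space_PiM merge_def fun_eq_iff PiE_def extensional_def)
  qed
  also have "\<dots> = (\<integral>y. \<integral>x. f (x(i := y)) \<partial>PiM I (\<lambda>_. lborel) \<partial>lborel)"
    by (rule lborel_PiM.product_integral_singleton) (rule meas)
  finally show "integral\<^sup>L (PiM (insert i I) (\<lambda>_. lborel)) f
    = (\<integral>y. \<integral>x. f (x(i := y)) \<partial>PiM I (\<lambda>_. lborel) \<partial>lborel)" .
qed

lemma tail_integrand_fun_upd:
  assumes "k < d"
  shows "tail_integrand d m Q a k (x(k := y)) =
    homogenize (Q k) (m k) y (sqrt (y\<^sup>2 + (L2_set x {Suc k..d})\<^sup>2)) * y ^ a k
      * tail_integrand d m Q a (Suc k) x"
proof -
  have "(\<Prod>i=Suc k..<d. homogenize (Q i) (m i) ((x(k := y)) i) (L2_set (x(k := y)) {i..d}))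
     = (\<Prod>i=Suc k..<d. homogenize (Q i) (m i) (x i) (L2_set x {i..d}))"
    by (intro prod.cong refl arg_cong2[where f = "homogenize _ _"] L2_set_cong) auto
  moreover have "(\<Prod>i=Suc k..d. (x(k := y)) i ^ a i) = (\<Prod>i=Suc k..d. x i ^ a i)"
    by (intro prod.cong) auto
  moreover have "(\<Prod>i=k..d. (x(k := y)) i ^ a i) = y ^ a k * (\<Prod>i=Suc k..d. (x(k := y)) i ^ a i)"
    using assms by (subst prod.atLeast_Suc_atMost) auto
  ultimately show ?thesis
    using assms unfolding tail_integrand_def harmonic_tail_def
    by (simp add: prod.atLeast_Suc_lessThan L2_set_fun_upd del: fun_upd_apply)
       (simp add: mult_ac)
qed

text \<open>The radial function is arbitrary in the induction: for fixed \<open>x k\<close>, the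
  induction hypothesis is applied to a function of the remaining norm that depends on
  \<open>x k\<close>.\<close>

lemma tail_integral:
  assumes "k \<le> d" "\<And>i. k \<le> i \<Longrightarrow> i < d \<Longrightarrow> degree (Q i) \<le> m i"
    and "\<phi> \<in> borel_measurable borel"
    and "integrable lborel
      (\<lambda>R. indicator {0<..} R * (\<phi> R * R ^ ((\<Sum>i=k..d. m i + a i) + (d - k))))"
  shows "(\<integral>x. \<phi> (L2_set x {k..d}) * tail_integrand d m Q a k x \<partial>PiM {k..d} (\<lambda>_. lborel))
    = tail_const d m Q a k *
      (\<integral>R. indicator {0<..} R * (\<phi> R * R ^ ((\<Sum>i=k..d. m i + a i) + (d - k))) \<partial>lborel)"
  using assms
proof (induction k arbitrary: \<phi> rule: inc_induct)
  case base
  note [measurable] = base.prems(2)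
  have "(\<integral>x. \<phi> (L2_set x {d..d}) * tail_integrand d m Q a d x \<partial>PiM {d..d} (\<lambda>_. lborel))
      = (\<integral>x. (\<lambda>y. \<phi> \<bar>y\<bar> * y ^ (m d + a d)) (x d) \<partial>PiM {d} (\<lambda>_. lborel))"
    by (simp add: tail_integrand_def harmonic_tail_def power_add mult.assoc)
  also have "\<dots> = (\<integral>y. \<phi> \<bar>y\<bar> * y ^ (m d + a d) \<partial>lborel)"
    by (rule lborel_PiM.product_integral_singleton) measurable
  also have "\<dots> = (1 + (-1) ^ (m d + a d)) *
      (\<integral>R. indicator {0<..} R * (\<phi> R * R ^ (m d + a d)) \<partial>lborel)"
    using base.prems by (intro integral_radial_1) auto
  finally show ?case by (simp add: tail_const_def)
next
  case (step k)
  note [measurable] = step.prems(2)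
  have kd: "k < d" using step.hyps by simp
  define n where "n = (\<Sum>i=Suc k..d. m i + a i) + (d - Suc k)"
  define N where "N = (\<Sum>i=k..d. m i + a i) + (d - k)"
  have N: "N = Suc (m k + a k + n)"
    using kd by (simp add: N_def n_def sum.atLeast_Suc_atMost)
  \<comment> \<open>For fixed \<open>y = x k\<close>, everything outside the later tail depends only
    on the remaining norm \<open>s\<close>.\<close>
  define \<phi>' where "\<phi>' y s = \<phi> (sqrt (y\<^sup>2 + s\<^sup>2)) * homogenize (Q k) (m k) y (sqrt (y\<^sup>2 + s\<^sup>2)) * y ^ a k"
    for y s
  define f where "f z = \<phi>' (fst z) (snd z) * snd z ^ n" for z
  define g where "g u = poly (Q k) (u / sqrt (1 + u\<^sup>2)) * (u / sqrt (1 + u\<^sup>2)) ^ a k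
      * (1 / sqrt (1 + u\<^sup>2)) ^ n" for u
  have [measurable]: "\<phi>' y \<in> borel_measurable borel" for y
    unfolding \<phi>'_def homogenize_def by measurable
  have f_meas: "f \<in> borel_measurable (lborel \<Otimes>\<^sub>M lborel)"
    unfolding f_def \<phi>'_def homogenize_def by measurable
  have f_polar: "R * f (half_plane_map (u, R)) = g u * (\<phi> R * R ^ N)" if "R > 0" for u R
  proof -
    have "\<phi>' (fst (half_plane_map (u, R))) (snd (half_plane_map (u, R)))
      = \<phi> R * (R ^ m k * poly (Q k) (u / sqrt (1 + u\<^sup>2))) * (R * (u / sqrt (1 + u\<^sup>2))) ^ a k"
      unfolding \<phi>'_def half_plane_map_norm[OF less_imp_le[OF that]]
        homogenize_mult[OF step.prems(1)[OF order.refl kd], symmetric]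
      by (simp only: half_plane_map_def prod.case fst_conv)
    then show ?thesis
      by (simp add: f_def g_def N half_plane_map_def power_mult_distrib power_add power_divide mult_ac)
  qed
  have g_int: "integrable lborel (\<lambda>u. g u / (1 + u\<^sup>2))"
    unfolding g_def by (rule integrable_angular_factor)
  note h_int = step.prems(3)[folded N_def]
  let ?F = "\<lambda>z. indicator {0<..} (snd z) * f z"
  have polar: "integrable (lborel \<Otimes>\<^sub>M lborel) ?F"
    "integral\<^sup>L (lborel \<Otimes>\<^sub>M lborel) ?F = (\<integral>u. g u / (1 + u\<^sup>2) \<partial>lborel) *
      (\<integral>R. indicator {0<..} R * (\<phi> R * R ^ N) \<partial>lborel)"
    by (rule half_plane_polar[OF f_meas f_polar g_int h_int], assumption)+
  let ?M = "PiM {Suc k..d} (\<lambda>_. lborel :: real measure)"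
  define G where "G x = \<phi> (L2_set x {k..d}) * tail_integrand d m Q a k x" for x
  have "integrable (PiM {k..d} (\<lambda>_. lborel)) G"
    unfolding G_def using step.prems(2,3) kd by (intro tail_integrable) auto
  then have G_int: "integrable (PiM (insert k {Suc k..d}) (\<lambda>_. lborel)) G"
    by (simp only: atLeastAtMost_eq_insert[OF kd])
  have G_upd: "G (x(k := y)) = \<phi>' y (L2_set x {Suc k..d}) * tail_integrand d m Q a (Suc k) x" for x y
    using kd by (simp only: G_def tail_integrand_fun_upd L2_set_fun_upd \<phi>'_def mult.assoc)
  have "(\<integral>x. G x \<partial>PiM {k..d} (\<lambda>_. lborel)) = (\<integral>y. \<integral>x. G (x(k := y)) \<partial>?M \<partial>lborel)"
    unfolding atLeastAtMost_eq_insert[OF kd] by (rule product_integral_insert_rev) (use G_int in auto)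
  also have "\<dots> = (\<integral>y. tail_const d m Q a (Suc k) * (\<integral>s. ?F (y, s) \<partial>lborel) \<partial>lborel)"
  proof (rule integral_cong_AE)
    show "(\<lambda>y. \<integral>x. G (x(k := y)) \<partial>?M) \<in> borel_measurable lborel"
      by (rule product_integral_insert_rev) (use G_int in auto)
    show "(\<lambda>y. tail_const d m Q a (Suc k) * (\<integral>s. ?F (y, s) \<partial>lborel)) \<in> borel_measurable lborel"
      using f_meas by measurable
    \<comment> \<open>The induction hypothesis needs an integrable slice, which Fubini provides for
      almost every \<open>y\<close>.\<close>
    show "AE y in lborel. (\<integral>x. G (x(k := y)) \<partial>?M)
        = tail_const d m Q a (Suc k) * (\<integral>s. ?F (y, s) \<partial>lborel)"
      using lborel_pair.AE_integrable_fst'[OF polar(1)]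
    proof eventually_elim
      case (elim y)
      have "(\<integral>x. \<phi>' y (L2_set x {Suc k..d}) * tail_integrand d m Q a (Suc k) x \<partial>?M)
        = tail_const d m Q a (Suc k) * (\<integral>s. indicator {0<..} s * (\<phi>' y s * s ^ n) \<partial>lborel)"
      proof (rule step.IH[folded n_def])
        show "integrable lborel (\<lambda>s. indicator {0<..} s * (\<phi>' y s * s ^ n))"
          using elim by (simp add: f_def)
        show "degree (Q i) \<le> m i" if "Suc k \<le> i" "i < d" for i
          using step.prems(1)[OF Suc_leD[OF that(1)] that(2)] .
      qed measurable
      then show ?case by (simp only: G_upd) (simp add: f_def)
    qed
  qed
  also have "\<dots> = tail_const d m Q a (Suc k) * integral\<^sup>L (lborel \<Otimes>\<^sub>M lborel) ?F"
    using lborel_pair.integral_fst'[OF polar(1)] by simp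
  also have "\<dots> = tail_const d m Q a k * (\<integral>R. indicator {0<..} R * (\<phi> R * R ^ N) \<partial>lborel)"
    unfolding polar(2) tail_const_Suc[OF kd] angular_factor_def g_def n_def by (simp add: mult.assoc)
  finally show ?case unfolding G_def N_def .
qed

section \<open>Polar form of the polynomials on the ball\<close>

text \<open>The change of variables takes place for the completed measure; \<open>meas\<close>
  allows returning to \<open>lborel\<close>.\<close>

lemma lborel_substitution:
  fixes f g g' :: "real \<Rightarrow> real"
  assumes S: "S \<in> sets borel" and inj: "inj_on g S"
    and der: "\<And>x. x \<in> S \<Longrightarrow> (g has_real_derivative g' x) (at x)"
    and f: "set_integrable lborel (g ` S) f"
    and meas: "set_borel_measurable borel S (\<lambda>x. \<bar>g' x\<bar> * f (g x))"
  shows "set_integrable lborel S (\<lambda>x. \<bar>g' x\<bar> * f (g x))"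
    and "(LBINT x:S. \<bar>g' x\<bar> * f (g x)) = (LBINT x:g ` S. f x)"
proof -
  have "f absolutely_integrable_on g ` S"
    using f borel_measurable_integrable[OF f[unfolded set_integrable_def]]
    by (simp add: set_integrable_def integrable_completion)
  then have *: "(\<lambda>x. \<bar>g' x\<bar> * f (g x)) absolutely_integrable_on S \<and>
      integral S (\<lambda>x. \<bar>g' x\<bar> * f (g x)) = integral (g ` S) f"
    using S by (subst has_absolute_integral_change_of_variables_1'[OF _ _ inj])
      (auto intro: DERIV_subset[OF der])
  then show int: "set_integrable lborel S (\<lambda>x. \<bar>g' x\<bar> * f (g x))"
    using meas by (simp add: set_integrable_def set_borel_measurable_def integrable_completion)
  show "(LBINT x:S. \<bar>g' x\<bar> * f (g x)) = (LBINT x:g ` S. f x)"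
    using * by (simp add: set_borel_integral_eq_integral(2)[OF int] set_borel_integral_eq_integral(2)[OF f])
qed

lemma set_integral_Ioo_eq_Icc:
  fixes f :: "real \<Rightarrow> real"
  assumes "set_integrable lborel {a..b} f"
  shows "set_integrable lborel {a<..<b} f" "(LBINT x:{a<..<b}. f x) = (LBINT x:{a..b}. f x)"
proof -
  show *: "set_integrable lborel {a<..<b} f"
    by (rule set_integrable_subset[OF assms]) auto
  show "(LBINT x:{a<..<b}. f x) = (LBINT x:{a..b}. f x)"
    unfolding set_borel_integral_eq_integral(2)[OF *] set_borel_integral_eq_integral(2)[OF assms]
    by (rule integral_open_interval_real[symmetric])
qed

text \<open>The map is the sine of \<open>arctan\<close>, with inverse
  \<open>t / sqrt (1 - t^2)\<close>.\<close>

lemma range_sin_arctan: "range (\<lambda>u. u / sqrt (1 + u\<^sup>2)) = {-1<..<1::real}"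
proof (intro equalityI subsetI)
  fix t :: real assume "t \<in> range (\<lambda>u. u / sqrt (1 + u\<^sup>2))"
  then obtain u where t: "t = u / sqrt (1 + u\<^sup>2)" by blast
  have "\<bar>u\<bar> < sqrt (1 + u\<^sup>2)" by (rule real_less_rsqrt) simp
  then show "t \<in> {-1<..<1}"
    using one_plus_square_pos[of u] by (auto simp: t field_simps abs_less_iff)
next
  fix t :: real assume t: "t \<in> {-1<..<1}"
  then have pos: "1 - t\<^sup>2 > 0" using one_minus_square_pos by auto
  have "1 + (t / sqrt (1 - t\<^sup>2))\<^sup>2 = 1 / (1 - t\<^sup>2)"
    using pos by (simp add: power_divide) (simp add: field_simps)
  then have eq: "sqrt (1 + (t / sqrt (1 - t\<^sup>2))\<^sup>2) = 1 / sqrt (1 - t\<^sup>2)"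
    by (simp only: real_sqrt_divide real_sqrt_one)
  have quot: "t = (t / s) / (1 / s)" if "s \<noteq> 0" for s :: real
    using that by simp
  show "t \<in> range (\<lambda>u. u / sqrt (1 + u\<^sup>2))"
  proof (rule range_eqI)
    show "t = (t / sqrt (1 - t\<^sup>2)) / sqrt (1 + (t / sqrt (1 - t\<^sup>2))\<^sup>2)"
      unfolding eq by (rule quot) (use pos in simp)
  qed
qed

lemma inj_sin_arctan: "inj (\<lambda>u. u / sqrt (1 + u\<^sup>2) :: real)"
proof (rule injI)
  fix u v :: real assume eq: "u / sqrt (1 + u\<^sup>2) = v / sqrt (1 + v\<^sup>2)"
  have "sin (arctan u) = sin (arctan v)"
    using eq by (simp add: sin_arctan)
  then have "arctan u = arctan v"
    by (metis arctan_lbound arctan_ubound arcsin_sin less_imp_le)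
  then show "u = v" by (simp only: arctan_eq_iff)
qed

text \<open>Substituting \<open>t = u / sqrt (1 + u^2)\<close>, with
  \<open>c = 1 / sqrt (1 + u^2)\<close>, gives \<open>dt = c^3 du\<close> and
  \<open>1 - t^2 = c^2\<close>. The exponent \<open>(n - 1) / 2\<close> thus leaves
  \<open>c ^ n * c^2\<close>, as required.\<close>

lemma angular_factor_eq_ultra_integral:
  assumes "(real n - 1) / 2 \<ge> - 1 / 2"
  shows "angular_factor q a n = ultra_integral ((real n - 1) / 2) (q * monom 1 a)"
proof -
  define p where "p = (real n - 1) / 2"
  define g where "g u = u / sqrt (1 + u\<^sup>2)" for u :: real
  define g' where "g' u = (1 / sqrt (1 + u\<^sup>2)) ^ 3" for u :: real
  define f where "f t = poly (q * monom 1 a) t * (1 - t\<^sup>2) powr p" for t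
  have der: "(g has_real_derivative g' u) (at u)" for u
  proof -
    define s where "s = sqrt (1 + u\<^sup>2)"
    have s: "s > 0" "s\<^sup>2 = 1 + u\<^sup>2"
      using one_plus_square_pos[of u] by (auto simp: s_def)
    have "(g has_real_derivative (1 * s - u * (inverse s / 2 * (2 * u))) / (s * s)) (at u)"
      unfolding g_def s_def using one_plus_square_pos[of u]
      by (auto intro!: derivative_eq_intros)
    also have "(1 * s - u * (inverse s / 2 * (2 * u))) / (s * s) = (s\<^sup>2 - u\<^sup>2) / s ^ 3"
      using s(1) by (simp add: field_simps power2_eq_square power3_eq_cube)
    also have "\<dots> = g' u"
      by (simp add: s(2) g'_def power_divide flip: s_def)
    finally show ?thesis .
  qed
  have range: "range g = {-1<..<1}"
    using range_sin_arctan by (simp add: g_def[abs_def])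
  have f_int: "set_integrable lborel {-1..1} f"
    unfolding f_def using assms by (intro set_integrable_ultra_weight) (simp add: p_def)
  have eq: "\<bar>g' u\<bar> * f (g u) = poly q (u / sqrt (1 + u\<^sup>2)) * (u / sqrt (1 + u\<^sup>2)) ^ a
      * (1 / sqrt (1 + u\<^sup>2)) ^ n / (1 + u\<^sup>2)" for u
  proof -
    define c where "c = 1 / sqrt (1 + u\<^sup>2)"
    have c: "c > 0" "c\<^sup>2 = 1 / (1 + u\<^sup>2)"
      using one_plus_square_pos[of u] by (auto simp: c_def power_divide)
    have "1 - (g u)\<^sup>2 = c\<^sup>2"
      using one_plus_square_pos[of u] by (simp add: g_def c power_divide field_simps)
    then have "(1 - (g u)\<^sup>2) powr p = c powr (2 * p)"
      using c(1) by (simp add: powr_powr flip: powr_numeral)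
    also have "2 * p = real n - 1" by (simp add: p_def)
    finally have "(1 - (g u)\<^sup>2) powr p = c powr (real n - 1)" .
    moreover have "\<bar>g' u\<bar> = c ^ 3"
      using c(1) by (simp add: g'_def flip: c_def)
    moreover have "c ^ 3 * c powr (real n - 1) = c ^ n * c\<^sup>2"
      using c(1) by (simp add: powr_diff powr_realpow power2_eq_square power3_eq_cube)
    ultimately have W: "\<bar>g' u\<bar> * (1 - (g u)\<^sup>2) powr p = c ^ n * (1 / (1 + u\<^sup>2))"
      by (simp only: c(2))
    have "\<bar>g' u\<bar> * f (g u) = poly q (g u) * g u ^ a * (\<bar>g' u\<bar> * (1 - (g u)\<^sup>2) powr p)"
      by (simp add: f_def poly_monom mult_ac)
    also have "\<dots> = poly q (g u) * g u ^ a * c ^ n / (1 + u\<^sup>2)"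
      by (simp only: W) (simp add: mult.assoc)
    finally show ?thesis by (simp only: g_def c_def)
  qed
  have "angular_factor q a n = (LBINT u:UNIV. \<bar>g' u\<bar> * f (g u))"
    by (simp add: angular_factor_def eq set_lebesgue_integral_def)
  also have "\<dots> = (LBINT t:range g. f t)"
  proof (rule lborel_substitution(2))
    show "inj g" using inj_sin_arctan by (simp add: g_def[abs_def])
    show "set_borel_measurable borel UNIV (\<lambda>u. \<bar>g' u\<bar> * f (g u))"
      by (simp add: eq set_borel_measurable_def)
    show "set_integrable lborel (range g) f"
      unfolding range by (rule set_integral_Ioo_eq_Icc(1)[OF f_int])
  qed (use der in auto)
  also have "\<dots> = ultra_integral p (q * monom 1 a)"
    unfolding range set_integral_Ioo_eq_Icc(2)[OF f_int]
    by (simp only: ultra_integral_def f_def[abs_def])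
  finally show ?thesis by (simp add: p_def)
qed

text \<open>If the degree condition already holds from \<open>Suc k\<close> on, a later factor
  vanishes. Otherwise the later degrees differ by an even number and the angular factor at
  \<open>k\<close> vanishes by orthogonality or parity.\<close>

lemma tail_const_eq_0:
  assumes "k \<le> d" "m d \<in> {0, 1}"
    and orth: "\<And>i. k \<le> i \<Longrightarrow> i < d \<Longrightarrow> ultra_orthogonal (harmonic_lambda d m i) (m i) (Q i)"
    and "(\<Sum>i=k..d. a i) < (\<Sum>i=k..d. m i) \<or> odd ((\<Sum>i=k..d. a i) + (\<Sum>i=k..d. m i))"
  shows "tail_const d m Q a k = 0"
  using assms(1,3,4)
proof (induction k rule: inc_induct)
  case base
  \<comment> \<open>Since \<open>m d\<close> is \<open>0\<close> or \<open>1\<close>, the inequality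
    \<open>a d < m d\<close> means \<open>a d = 0\<close> and \<open>m d = 1\<close>, so the sum is
    odd in either case.\<close>
  then have "odd (m d + a d)" using assms(2) by auto
  then show ?case by (simp add: tail_const_def)
next
  case (step k)
  have kd: "k < d" using step.hyps by simp
  define A where "A = (\<Sum>i=Suc k..d. a i)"
  define N where "N = (\<Sum>i=Suc k..d. m i)"
  have sums: "(\<Sum>i=k..d. a i) = a k + A" "(\<Sum>i=k..d. m i) = m k + N"
    using kd by (simp_all add: A_def N_def sum.atLeast_Suc_atMost)
  show ?case
  proof (cases "A < N \<or> odd (A + N)")
    case True
    then have "tail_const d m Q a (Suc k) = 0"
      using step.IH step.prems(1) Suc_leD unfolding A_def N_def by blast
    then show ?thesis by (simp add: tail_const_Suc[OF kd])
  next
    case False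
    \<comment> \<open>The surplus \<open>2 * e\<close> of the later degrees becomes a shift of the
      Gegenbauer weight exponent by \<open>e\<close>.\<close>
    then obtain e where e: "A = N + 2 * e"
      by (metis add_diff_inverse_nat dvd_def even_add even_diff_nat not_less)
    have n: "(\<Sum>l=Suc k..d. m l + a l) + (d - Suc k) = 2 * N + 2 * e + (d - Suc k)"
      using e by (simp add: sum.distrib A_def N_def)
    have lam: "harmonic_lambda d m k = real N + (real d - real k - 1) / 2"
      by (simp add: harmonic_lambda_def harmonic_beta_def N_def)
    have p: "(real (2 * N + 2 * e + (d - Suc k)) - 1) / 2 = harmonic_lambda d m k - 1 / 2 + real e"
      using kd by (simp add: lam of_nat_diff field_simps)
    have lam0: "harmonic_lambda d m k \<ge> 0"
      using kd by (simp add: lam)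
    have "angular_factor (Q k) (a k) ((\<Sum>l=Suc k..d. m l + a l) + (d - Suc k))
        = ultra_integral (harmonic_lambda d m k - 1 / 2 + real e) (Q k * monom 1 (a k))"
      unfolding n p[symmetric] using lam0
      by (intro angular_factor_eq_ultra_integral) (simp add: p)
    also have "\<dots> = 0"
      using step.prems(2) e kd step.prems(1)[of k]
      by (intro ultra_integral_orthogonal_eq_0[OF lam0]) (auto simp: sums)
    finally show ?thesis by (simp add: tail_const_Suc[OF kd])
  qed
qed

lemma tail_const_eq_0_mono:
  assumes "k' \<le> k" "k \<le> d" "tail_const d m Q a k = 0"
  shows "tail_const d m Q a k' = 0"
  using assms
proof (induction k' rule: inc_induct)
  case (step k')
  then show ?case by (simp add: tail_const_Suc)
qed

section \<open>The spherical harmonic in Cartesian coordinates\<close>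

text \<open>At \<open>k = d - 1\<close> the parameter \<open>harmonic_lambda d m k\<close> equals
  \<open>m d\<close>; the values \<open>0\<close> and \<open>1\<close> match the Chebyshev
  polynomials of the first and second kind coming from \<open>cos\<close> and \<open>sin\<close> of
  multiples of \<open>\<theta> 1\<close>.\<close>

definition angular_poly :: "nat \<Rightarrow> (nat \<Rightarrow> nat) \<Rightarrow> nat \<Rightarrow> real poly" where
  "angular_poly d m k = (if Suc k < d then gegenbauer (harmonic_lambda d m k) (m k)
     else if m d = 0 then cheb_T (m k) else cheb_U (m k))"

lemma ultra_orthogonal_angular_poly:
  assumes "m d \<in> {0, 1}" "k < d"
  shows "ultra_orthogonal (harmonic_lambda d m k) (m k) (angular_poly d m k)"
proof (cases "Suc k < d")
  case True
  then have "harmonic_lambda d m k > 0"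
    by (simp add: harmonic_lambda_def add_nonneg_pos)
  then show ?thesis
    using True by (simp add: angular_poly_def ultra_orthogonal_gegenbauer)
next
  case False
  with assms have d: "d = Suc k" by simp
  have "harmonic_lambda d m k = real (m d)"
    by (simp add: harmonic_lambda_def harmonic_beta_def d)
  then show ?thesis
    using assms ultra_orthogonal_cheb_T ultra_orthogonal_cheb_U
    by (auto simp: angular_poly_def d)
qed

text \<open>For \<open>k < d\<close> the product involves only angles in \<open>[0, pi]\<close>,
  whose sines are nonnegative. For \<open>k = d\<close> it also contains
  \<open>sin (\<theta> 1)\<close>, of either sign, hence the absolute value.\<close>

lemma polar_coords_tail:
  assumes "polar_coords d x \<rho> \<theta>" "d \<ge> 2" "1 \<le> k" "k \<le> d"
  shows "L2_set x {k..d} = \<bar>\<rho> * (\<Prod>l=1..<k. sin (\<theta> (d - l)))\<bar>"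
    and "k < d \<Longrightarrow> \<rho> * (\<Prod>l=1..<k. sin (\<theta> (d - l))) \<ge> 0"
proof -
  define R where "R k = \<rho> * (\<Prod>l=1..<k. sin (\<theta> (d - l)))" for k
  have R_Suc: "R (Suc k) = R k * sin (\<theta> (d - k))" if "1 \<le> k" for k
    using that by (simp add: R_def)
  have x: "x k = R k * cos (\<theta> (d - k))" if "1 \<le> k" "k < d" for k
    using assms(1) that by (simp add: polar_coords_def R_def)
  have xd: "x d = R d"
    using assms(1) by (simp add: polar_coords_def R_def)
  show "L2_set x {k..d} = \<bar>R k\<bar>"
    using assms(4,3)
  proof (induction k rule: inc_induct)
    case (step k)
    have "L2_set x {k..d} = sqrt ((x k)\<^sup>2 + (L2_set x {Suc k..d})\<^sup>2)"
      using step.hyps L2_set_fun_upd[of k d x "x k"] by simp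
    also have "\<dots> = sqrt ((R k)\<^sup>2 * ((cos (\<theta> (d - k)))\<^sup>2 + (sin (\<theta> (d - k)))\<^sup>2))"
    proof -
      have "L2_set x {Suc k..d} = \<bar>R (Suc k)\<bar>"
        using step by simp
      then show ?thesis
        by (simp only: x[OF step.prems step.hyps(2)] R_Suc[OF step.prems] power2_abs
            power_mult_distrib distrib_left)
    qed
    finally show ?case by simp
  qed (simp add: xd)
  show "R k \<ge> 0" if "k < d"
  proof -
    have "sin (\<theta> (d - l)) \<ge> 0" if "l \<in> {1..<k}" for l
    proof -
      have "d - l \<in> {2..d - 1}" using that \<open>k < d\<close> by auto
      then show ?thesis
        using assms(1) by (intro sin_ge_zero) (simp_all only: polar_coords_def Ball_def)
    qed
    then show ?thesis
      unfolding R_def using assms(1)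
      by (intro mult_nonneg_nonneg prod_nonneg) (auto simp: polar_coords_def)
  qed
qed

text \<open>The right side mentions only the point \<open>x\<close>, so the value does not depend on
  the choice of angles, as the description in \<open>ball_mop\<close> demands.\<close>

lemma spherical_harmonic_eq:
  assumes polar: "polar_coords d x \<rho> \<theta>" and d: "d \<ge> 2" and md: "m d \<in> {0, 1}"
  shows "spherical_harmonic d m \<rho> \<theta> = harmonic_tail d m (angular_poly d m) 1 x"
proof -
  define R where "R k = \<rho> * (\<Prod>l=1..<k. sin (\<theta> (d - l)))" for k
  have R_Suc: "R (Suc k) = R k * sin (\<theta> (d - k))" if "1 \<le> k" for k
    using that by (simp add: R_def)
  have x: "x k = R k * cos (\<theta> (d - k))" if "1 \<le> k" "k < d" for k
    using polar that by (simp add: polar_coords_def R_def)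
  have xd: "x d = R d"
    using polar by (simp add: polar_coords_def R_def)
  have L2: "L2_set x {k..d} = R k" if "1 \<le> k" "k < d" for k
    using polar_coords_tail[OF polar d that(1) less_imp_le[OF that(2)]] that
    by (simp add: R_def)
  let ?Q = "angular_poly d m"
  let ?H = "\<lambda>k. homogenize (?Q k) (m k) (x k) (L2_set x {k..d})"
  have H: "?H k = R k ^ m k * poly (?Q k) (cos (\<theta> (d - k)))" if "1 \<le> k" "k < d" for k
    using ultra_orthogonal_angular_poly[of m d k, OF md that(2)]
    unfolding L2[OF that] x[OF that] by (intro homogenize_mult) (simp add: ultra_orthogonal_def)
  define F where "F k = sin (\<theta> (d - k)) ^ harmonic_beta d m k
      * poly (gegenbauer (harmonic_lambda d m k) (m k)) (cos (\<theta> (d - k)))" for k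
  \<comment> \<open>The powers telescope: \<open>R j\<close> to the remaining degree splits into
    \<open>R j ^ m j\<close>, used by the homogenized factor, and a power that the matching sine
    power turns into one of \<open>R (Suc j)\<close>.\<close>
  have step: "\<rho> ^ (\<Sum>i=1..d. m i) * (\<Prod>k=1..<j. F k) = (\<Prod>k=1..<j. ?H k) * R j ^ (\<Sum>i=j..d. m i)"
    if "1 \<le> j" "j < d" for j
    using that
  proof (induction j rule: dec_induct)
    case base
    then show ?case by (simp add: R_def)
  next
    case (step j)
    have "\<rho> ^ (\<Sum>i=1..d. m i) * (\<Prod>k=1..<Suc j. F k)
        = (\<rho> ^ (\<Sum>i=1..d. m i) * (\<Prod>k=1..<j. F k)) * F j"
      using step.hyps by simp
    also have "\<dots> = (\<Prod>k=1..<j. ?H k) * (R j ^ (\<Sum>i=j..d. m i) * F j)"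
      using step by simp
    also have "(\<Sum>i=j..d. m i) = m j + (\<Sum>i=Suc j..d. m i)"
      using step.prems by (simp add: sum.atLeast_Suc_atMost)
    also have "R j ^ \<dots> * F j = ?H j * R (Suc j) ^ (\<Sum>i=Suc j..d. m i)"
      using step.hyps step.prems H[of j]
      by (simp add: R_Suc F_def harmonic_beta_def angular_poly_def power_add power_mult_distrib)
    finally show ?case using step.hyps by simp
  qed
  obtain e where e: "d = Suc (Suc e)"
    using d by (metis add_2_eq_Suc le_Suc_ex)
  define g where "g = (if m d = 0 then cos (real (m (d - 1) + m d) * \<theta> 1)
        else sin (real (m (d - 1) + m d) * \<theta> 1))"
  have "spherical_harmonic d m \<rho> \<theta> = \<rho> ^ (\<Sum>i=1..d. m i) * (\<Prod>k=1..<Suc e. F k) * g"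
    by (simp add: spherical_harmonic_def F_def g_def e atLeastLessThanSuc_atLeastAtMost)
  also have "\<dots> = (\<Prod>k=1..<Suc e. ?H k) * (R (Suc e) ^ (m (Suc e) + m d) * g)"
    using step[of "Suc e"] e by simp
  \<comment> \<open>The last angle: \<open>cos (m \<theta>)\<close> is the first-kind polynomial at
    \<open>cos \<theta>\<close>, while \<open>sin ((m + 1) \<theta>)\<close> is the second-kind one
    times \<open>sin \<theta>\<close>, whose sine supplies the factor \<open>x d\<close>.\<close>
  also have "R (Suc e) ^ (m (Suc e) + m d) * g = ?H (Suc e) * x d ^ m d"
  proof (cases "m d = 0")
    case True
    then show ?thesis
      using e H[of "Suc e"] by (simp add: angular_poly_def poly_cheb_T_cos g_def)
  next
    case False
    then have "m d = 1" using md by auto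
    moreover have "x d = R (Suc e) * sin (\<theta> 1)"
      using R_Suc[of "Suc e"] e xd by simp
    moreover have "sin (\<theta> 1) * poly (cheb_U (m (Suc e))) (cos (\<theta> 1)) = sin (real (Suc (m (Suc e))) * \<theta> 1)"
      by (rule poly_cheb_U_cos)
    ultimately show ?thesis
      using e H[of "Suc e"] by (simp add: angular_poly_def g_def mult_ac)
  qed
  also have "(\<Prod>k=1..<Suc e. ?H k) * (?H (Suc e) * x d ^ m d) = harmonic_tail d m ?Q 1 x"
    by (simp add: harmonic_tail_def e)
  finally show ?thesis .
qed

lemma polar_coords_exist:
  assumes d: "d \<ge> 2"
  shows "\<exists>\<theta>. polar_coords d x (L2_set x {1..d}) \<theta>"
proof -
  obtain e where e: "d = Suc (Suc e)"
    using d by (metis add_2_eq_Suc le_Suc_ex)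
  define z where "z = Complex (x (Suc e)) (x d)"
  define R where "R k = L2_set x {k..d}" for k
  \<comment> \<open>If some \<open>R k = 0\<close>, division by zero yields \<open>arccos 0\<close>;
    this is harmless because then \<open>x k\<close> and \<open>R (Suc k)\<close> vanish
    too.\<close>
  define \<theta> where "\<theta> l = (if l = 1 then Arg2pi z else arccos (x (d - l) / R (d - l)))" for l
  have R_rec: "R k = sqrt ((x k)\<^sup>2 + (R (Suc k))\<^sup>2)" if "k < d" for k
    unfolding R_def using L2_set_fun_upd[OF that, of x "x k"] by simp
  have R_nonneg: "R k \<ge> 0" for k by (simp add: R_def)
  have abs_le: "\<bar>x k\<bar> \<le> R k" if "k \<le> d" for k
    unfolding R_def using that by (intro abs_component_le_L2_set) auto
  have quot: "\<bar>x k / R k\<bar> \<le> 1" if "k \<le> d" for k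
    using abs_le[OF that] R_nonneg[of k] by (cases "R k = 0") auto
  have th: "\<theta> (d - k) = arccos (x k / R k)" if "k < Suc e" for k
    using that e by (auto simp: \<theta>_def)
  have R_cos: "R k * cos (\<theta> (d - k)) = x k" if "k < Suc e" for k
    using quot[of k] abs_le[of k] that e unfolding th[OF that]
    by (cases "R k = 0") (auto simp: cos_arccos_abs)
  have R_sin: "R k * sin (\<theta> (d - k)) = R (Suc k)" if "k < Suc e" for k
  proof -
    have "sin (\<theta> (d - k)) = sqrt (1 - (x k / R k)\<^sup>2)"
      unfolding th[OF that] using quot[of k] that e by (intro sin_arccos_abs) auto
    then have "R k * sin (\<theta> (d - k)) = sqrt ((R k)\<^sup>2) * sqrt (1 - (x k / R k)\<^sup>2)"
      using R_nonneg[of k] by simp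
    also have "\<dots> = sqrt ((R k)\<^sup>2 * (1 - (x k / R k)\<^sup>2))"
      by (rule real_sqrt_mult[symmetric])
    also have "(R k)\<^sup>2 * (1 - (x k / R k)\<^sup>2) = (R k)\<^sup>2 - (x k)\<^sup>2"
      using abs_le[of k] that e
      by (cases "R k = 0") (auto simp: power_divide right_diff_distrib)
    also have "(R k)\<^sup>2 - (x k)\<^sup>2 = (R (Suc k))\<^sup>2"
      using R_rec[of k] that e by (simp add: add_nonneg_nonneg)
    finally show ?thesis using R_nonneg[of "Suc k"] by simp
  qed
  have R_prod: "R k = R 1 * (\<Prod>l=1..<k. sin (\<theta> (d - l)))" if "1 \<le> k" "k \<le> Suc e" for k
    using that
  proof (induction k rule: dec_induct)
    case (step k)
    then show ?case using R_sin[of k] by (simp add: mult.assoc[symmetric])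
  qed simp
  have "cmod z = R (Suc e)"
    using R_rec[of "Suc e"] by (simp add: z_def cmod_def e R_def)
  then have zc: "R (Suc e) * cos (\<theta> 1) = x (Suc e)" and zs: "R (Suc e) * sin (\<theta> 1) = x d"
    using cos_Arg2pi[of z] sin_Arg2pi[of z] by (simp_all add: \<theta>_def z_def)
  have "polar_coords d x (R 1) \<theta>"
    unfolding polar_coords_def
  proof (intro conjI ballI)
    show "0 \<le> \<theta> 1" "\<theta> 1 < 2 * pi"
      using Arg2pi[of z] by (simp_all add: \<theta>_def)
    show "0 \<le> \<theta> k" "\<theta> k \<le> pi" if "k \<in> {2..d - 1}" for k
    proof -
      have "-1 \<le> x (d - k) / R (d - k)" "x (d - k) / R (d - k) \<le> 1"
        using quot[of "d - k"] by linarith+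
      then show "0 \<le> \<theta> k" "\<theta> k \<le> pi"
        using that by (auto simp: \<theta>_def intro!: arccos_lbound arccos_ubound)
    qed
    show "x i = R 1 * (\<Prod>l=1..<i. sin (\<theta> (d - l))) * cos (\<theta> (d - i))" if "i \<in> {1..<d}" for i
      using R_prod[of i] R_cos[of i] zc that e by (cases "i = Suc e") auto
    show "x d = R 1 * (\<Prod>l=1..<d. sin (\<theta> (d - l)))"
      using R_prod[of "Suc e"] zs e by simp
  qed (rule R_nonneg)
  then show ?thesis by (auto simp: R_def)
qed

lemma ball_mop_eq:
  assumes "d \<ge> 2" "m d \<in> {0, 1}" and M: "M = (\<Sum>l=1..r. n l) - 2 * (\<Sum>l=1..r. j l)"
  shows "ball_mop d r \<mu> n j m x
    = poly (jacobi_pineiro (real M + (real d - 2) / 2) r \<mu> j) ((L2_set x {1..d})\<^sup>2)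
        * harmonic_tail d m (angular_poly d m) 1 x"
proof -
  let ?p = "jacobi_pineiro (real M + (real d - 2) / 2) r \<mu> j"
  have "poly ?p (\<rho>\<^sup>2) * spherical_harmonic d m \<rho> \<theta>
      = poly ?p ((L2_set x {1..d})\<^sup>2) * harmonic_tail d m (angular_poly d m) 1 x"
    if "polar_coords d x \<rho> \<theta>" for \<rho> \<theta>
    using polar_coords_tail(1)[OF that assms(1), of 1] spherical_harmonic_eq[of d x _ _ m, OF that assms(1,2)] assms(1)
    by simp
  note eq = this
  obtain \<theta> where \<theta>: "polar_coords d x (L2_set x {1..d}) \<theta>"
    using polar_coords_exist[OF assms(1)] by blast
  show ?thesis
    unfolding ball_mop_def Let_def M[symmetric]
  proof (rule the_equality)
    show "\<exists>\<rho> \<theta>. polar_coords d x \<rho> \<theta> \<and>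
        poly ?p ((L2_set x {1..d})\<^sup>2) * harmonic_tail d m (angular_poly d m) 1 x
          = poly ?p (\<rho>\<^sup>2) * spherical_harmonic d m \<rho> \<theta>"
      using \<theta> eq[OF \<theta>] by metis
  qed (auto simp: eq)
qed

section \<open>The radial integral and the vanishing theorem\<close>

text \<open>Under \<open>t = R^2\<close>, the measure \<open>R ^ N dR\<close> becomes half of
  \<open>t powr ((N - 1) / 2) dt\<close>. The factor \<open>t ^ 0\<close> keeps the form of
  \<open>integral_poly_jp_weight\<close>.\<close>

lemma radial_integral:
  fixes p :: "real poly" and \<mu> :: real and N :: nat
  assumes "N \<ge> 1" "\<mu> > -1"
  defines "h \<equiv> \<lambda>R. indicator {0<..} R *
      (poly p (R\<^sup>2) * (1 - R\<^sup>2) powr \<mu> * indicator {..1} R * R ^ N)"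
  shows "integrable lborel h"
    and "(\<integral>R. h R \<partial>lborel)
      = (LBINT t:{0..1}. poly p t * t ^ 0 * jp_weight ((real N - 1) / 2) \<mu> t) / 2"
proof -
  define \<alpha> where "\<alpha> = (real N - 1) / 2"
  define f where "f t = poly p t * t ^ 0 * jp_weight \<alpha> \<mu> t" for t
  have f_int: "set_integrable lborel {0..1} f"
    unfolding f_def using assms by (intro integral_poly_jp_weight(1)) (auto simp: \<alpha>_def)
  have img: "(\<lambda>R. R\<^sup>2) ` {0<..<1} = {0<..<1::real}"
  proof (intro equalityI subsetI)
    fix t :: real assume "t \<in> {0<..<1}"
    then show "t \<in> (\<lambda>R. R\<^sup>2) ` {0<..<1}"
      by (intro image_eqI[of _ _ "sqrt t"]) auto
  qed (auto simp: power_less_one_iff)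
  have eq: "\<bar>2 * R\<bar> * f (R\<^sup>2) = 2 * (poly p (R\<^sup>2) * (1 - R\<^sup>2) powr \<mu> * R ^ N)"
    if "R \<in> {0<..<1}" for R
  proof -
    have "R * (R\<^sup>2) powr \<alpha> = R powr 1 * R powr (2 * \<alpha>)"
      using that by (simp add: powr_powr flip: powr_numeral)
    also have "2 * \<alpha> = real N - 1" by (simp add: \<alpha>_def)
    also have "R powr 1 * R powr (real N - 1) = R powr real N"
      by (simp only: powr_add[symmetric]) simp
    also have "\<dots> = R ^ N"
      using that by (simp add: powr_realpow)
    finally show ?thesis
      using that by (simp add: f_def jp_weight_def algebra_simps)
  qed
  have sub: "set_integrable lborel {0<..<1} (\<lambda>R. \<bar>2 * R\<bar> * f (R\<^sup>2))"
    "(LBINT R:{0<..<1}. \<bar>2 * R\<bar> * f (R\<^sup>2)) = (LBINT t:(\<lambda>R. R\<^sup>2) ` {0<..<1}. f t)"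
  proof -
    have 1: "inj_on (\<lambda>R. R\<^sup>2) {0<..<1::real}"
      by (auto intro!: inj_onI simp: power2_eq_iff)
    have 2: "((\<lambda>R. R\<^sup>2) has_real_derivative 2 * R) (at R)" for R :: real
      by (auto intro!: derivative_eq_intros)
    have 3: "set_integrable lborel ((\<lambda>R. R\<^sup>2) ` {0<..<1}) f"
      unfolding img by (rule set_integral_Ioo_eq_Icc(1)[OF f_int])
    have 4: "set_borel_measurable borel {0<..<1} (\<lambda>R. \<bar>2 * R\<bar> * f (R\<^sup>2))"
      by (simp add: set_borel_measurable_def f_def jp_weight_def)
    show "set_integrable lborel {0<..<1} (\<lambda>R. \<bar>2 * R\<bar> * f (R\<^sup>2))"
      using lborel_substitution(1)[OF _ 1 2 3 4] by simp
    show "(LBINT R:{0<..<1}. \<bar>2 * R\<bar> * f (R\<^sup>2)) = (LBINT t:(\<lambda>R. R\<^sup>2) ` {0<..<1}. f t)"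
      using lborel_substitution(2)[OF _ 1 2 3 4] by simp
  qed
  \<comment> \<open>The two intervals differ in \<open>R = 1\<close>, where the weight is zero by
    \<open>0 powr \<mu> = 0\<close>.\<close>
  have h: "indicator {0<..<1} R *\<^sub>R (\<bar>2 * R\<bar> * f (R\<^sup>2)) = 2 * h R" for R
    using eq[of R] by (auto simp: h_def indicator_def)
  have "integrable lborel (\<lambda>R. 1 / 2 * (2 * h R))"
    using sub(1) unfolding set_integrable_def h by (rule integrable_mult_right)
  then show "integrable lborel h" by simp
  have "2 * (\<integral>R. h R \<partial>lborel) = (LBINT R:{0<..<1}. \<bar>2 * R\<bar> * f (R\<^sup>2))"
    unfolding set_lebesgue_integral_def h by simp
  also have "\<dots> = (LBINT t:{0..1}. f t)"
    unfolding sub(2) img set_integral_Ioo_eq_Icc(2)[OF f_int] ..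
  finally show "(\<integral>R. h R \<partial>lborel)
      = (LBINT t:{0..1}. poly p t * t ^ 0 * jp_weight ((real N - 1) / 2) \<mu> t) / 2"
    by (simp add: f_def \<alpha>_def)
qed

text \<open>Integrability is part of the conclusion because a Bochner integral of a non-integrable
  function is zero by convention. The strict inequality before \<open>odd\<close> makes the natural
  subtraction a true difference.\<close>

theorem proposition13:
  fixes d r M :: nat and \<mu> :: "nat \<Rightarrow> real" and n j a m :: "nat \<Rightarrow> nat"
  assumes "d \<ge> 2"
    and "\<forall>l\<in>{1..r}. \<mu> l > -1"
    and "\<forall>i\<in>{1..r}. \<forall>i'\<in>{1..r}. i \<noteq> i' \<longrightarrow> \<mu> i - \<mu> i' \<notin> \<int>"
    and "2 * (\<Sum>l=1..r. j l) \<le> (\<Sum>l=1..r. n l)"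
    and "M = (\<Sum>l=1..r. n l) - 2 * (\<Sum>l=1..r. j l)"
    and "(\<Sum>i=1..d. m i) = M"
    and "m d \<in> {0, 1}"
  shows "\<forall>l\<in>{1..r}.
     set_integrable (lborel_dim d) (unit_ball d)
       (\<lambda>x. ball_mop d r \<mu> n j m x * (\<Prod>i=1..d. x i ^ a i) * ball_weight d (\<mu> l) x) \<and>
     ((\<Sum>i=1..d. a i) < M + 2 * j l \<or>
      (\<exists>k\<in>{1..d-1}.
         (\<Sum>i=d-k..d. a i) < (\<Sum>i=d-k..d. m i) \<or>
         (\<Sum>i=d-k..d. m i) < (\<Sum>i=d-k..d. a i) \<and>
           odd ((\<Sum>i=d-k..d. a i) - (\<Sum>i=d-k..d. m i))) \<longrightarrow>
      (LINT x:unit_ball d|lborel_dim d.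
         ball_mop d r \<mu> n j m x * (\<Prod>i=1..d. x i ^ a i) * ball_weight d (\<mu> l) x) = 0)"
proof (intro ballI conjI impI)
  fix l assume l: "l \<in> {1..r}"
  define \<alpha> where "\<alpha> = real M + (real d - 2) / 2"
  define p where "p = jacobi_pineiro \<alpha> r \<mu> j"
  define A where "A = (\<Sum>i=1..d. a i)"
  define N where "N = (\<Sum>i=1..d. m i + a i) + (d - 1)"
  define w where "w = Gamma (\<mu> l + 1 + real d / 2) / (pi powr (real d / 2) * Gamma (\<mu> l + 1))"
  \<comment> \<open>All radial factors in one function; the indicator cuts out the ball.\<close>
  define \<phi> where "\<phi> R = w * (poly p (R\<^sup>2) * (1 - R\<^sup>2) powr \<mu> l * indicator {..1} R)" for R
  let ?Q = "angular_poly d m"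
  have \<mu>: "\<mu> l > -1" using assms(2) l by blast
  have N: "N = M + A + (d - 1)" "N \<ge> 1"
    using assms(1,6) by (auto simp: N_def A_def sum.distrib)
  have orth: "ultra_orthogonal (harmonic_lambda d m i) (m i) (?Q i)" if "i < d" for i
    using assms(7) that by (rule ultra_orthogonal_angular_poly)
  have \<phi>_meas: "\<phi> \<in> borel_measurable borel"
    unfolding \<phi>_def by measurable
  have h: "indicator {0<..} R * (\<phi> R * R ^ N)
      = w * (indicator {0<..} R * (poly p (R\<^sup>2) * (1 - R\<^sup>2) powr \<mu> l * indicator {..1} R * R ^ N))" for R
    by (simp add: \<phi>_def)
  have h_int: "integrable lborel (\<lambda>R. indicator {0<..} R * (\<phi> R * R ^ N))"
    unfolding h using radial_integral(1)[OF N(2) \<mu>] by (rule integrable_mult_right)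
  have eq: "indicator (unit_ball d) x *\<^sub>R
        (ball_mop d r \<mu> n j m x * (\<Prod>i=1..d. x i ^ a i) * ball_weight d (\<mu> l) x)
      = \<phi> (L2_set x {1..d}) * tail_integrand d m ?Q a 1 x"
    if "x \<in> space (lborel_dim d)" for x
    using that
    by (auto simp: ball_mop_eq[where m = m, OF assms(1,7,5)] ball_weight_def tail_integrand_def \<phi>_def w_def p_def
        \<alpha>_def unit_ball_def indicator_def space_PiM)
  show "set_integrable (lborel_dim d) (unit_ball d)
       (\<lambda>x. ball_mop d r \<mu> n j m x * (\<Prod>i=1..d. x i ^ a i) * ball_weight d (\<mu> l) x)"
    unfolding set_integrable_def
    by (subst Bochner_Integration.integrable_cong[OF refl eq])
       (use assms(1) \<phi>_meas h_int in \<open>auto intro!: tail_integrable simp: N_def\<close>)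
  have int: "(LINT x:unit_ball d|lborel_dim d.
         ball_mop d r \<mu> n j m x * (\<Prod>i=1..d. x i ^ a i) * ball_weight d (\<mu> l) x)
      = tail_const d m ?Q a 1 * (\<integral>R. indicator {0<..} R * (\<phi> R * R ^ N) \<partial>lborel)"
    unfolding set_lebesgue_integral_def N_def
    by (subst Bochner_Integration.integral_cong[OF refl eq], assumption, rule tail_integral)
       (use assms(1) \<phi>_meas h_int orth in \<open>auto simp: N_def ultra_orthogonal_def\<close>)
  assume *: "(\<Sum>i=1..d. a i) < M + 2 * j l \<or>
      (\<exists>k\<in>{1..d-1}.
         (\<Sum>i=d-k..d. a i) < (\<Sum>i=d-k..d. m i) \<or>
         (\<Sum>i=d-k..d. m i) < (\<Sum>i=d-k..d. a i) \<and>
           odd ((\<Sum>i=d-k..d. a i) - (\<Sum>i=d-k..d. m i)))"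
  have zero: "tail_const d m ?Q a k = 0"
    if "k \<le> d" "(\<Sum>i=k..d. a i) < (\<Sum>i=k..d. m i) \<or> odd ((\<Sum>i=k..d. a i) + (\<Sum>i=k..d. m i))" for k
    using that(1) assms(7) orth that(2) by (rule tail_const_eq_0)
  from * show "(LINT x:unit_ball d|lborel_dim d.
         ball_mop d r \<mu> n j m x * (\<Prod>i=1..d. x i ^ a i) * ball_weight d (\<mu> l) x) = 0"
  proof
    assume less: "(\<Sum>i=1..d. a i) < M + 2 * j l"
    show ?thesis
    proof (cases "A < M \<or> odd (A + M)")
      case True
      then show ?thesis
        using zero[of 1] assms(1,6) unfolding int A_def by simp
    next
      case False
      \<comment> \<open>Here orthogonality at index \<open>1\<close> gives nothing, and the radial
        integral must vanish instead.\<close>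
      then obtain s where s: "A = M + 2 * s"
        by (metis add_diff_inverse_nat dvd_def even_add even_diff_nat not_less)
      then have "s < j l" using less by (simp add: A_def)
      then have "(LBINT t:{0..1}. poly p t * t ^ s * jp_weight \<alpha> (\<mu> l) t) = 0"
        using type_II_jp_jacobi_pineiro[of \<alpha> r \<mu> j] assms(1,2) l
        by (auto simp: type_II_jp_def p_def \<alpha>_def)
      also have "(LBINT t:{0..1}. poly p t * t ^ s * jp_weight \<alpha> (\<mu> l) t)
        = (LBINT t:{0..1}. poly p t * t ^ 0 * jp_weight ((real N - 1) / 2) (\<mu> l) t)"
      proof (intro set_lebesgue_integral_cong allI impI)
        \<comment> \<open>With \<open>|a| = M + 2 s\<close>, the radial exponent is
          \<open>N = 2 M + 2 s + d - 1\<close>, so the substitution yields precisely the extra power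
          \<open>t ^ s\<close>.\<close>
        have \<alpha>': "(real N - 1) / 2 = \<alpha> + real s"
          using assms(1) by (simp add: N s \<alpha>_def of_nat_diff field_simps)
        show "poly p t * t ^ s * jp_weight \<alpha> (\<mu> l) t
            = poly p t * t ^ 0 * jp_weight ((real N - 1) / 2) (\<mu> l) t" if "t \<in> {0..1}" for t
          unfolding \<alpha>' using that
          by (cases "t = 0") (simp_all add: jp_weight_def powr_add powr_realpow)
      qed simp
      finally have "(\<integral>R. indicator {0<..} R * (\<phi> R * R ^ N) \<partial>lborel) = 0"
        unfolding h using radial_integral(2)[OF N(2) \<mu>, of p] by simp
      then show ?thesis unfolding int by simp
    qed
  next
    assume "\<exists>k\<in>{1..d-1}.
         (\<Sum>i=d-k..d. a i) < (\<Sum>i=d-k..d. m i) \<or>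
         (\<Sum>i=d-k..d. m i) < (\<Sum>i=d-k..d. a i) \<and>
           odd ((\<Sum>i=d-k..d. a i) - (\<Sum>i=d-k..d. m i))"
    moreover have "odd (p + q)" if "odd (p - q)" "q < p" for p q :: nat
      using that by presburger
    ultimately obtain k where k: "k \<in> {1..d-1}" "(\<Sum>i=d-k..d. a i) < (\<Sum>i=d-k..d. m i) \<or>
        odd ((\<Sum>i=d-k..d. a i) + (\<Sum>i=d-k..d. m i))"
      by blast
    then have "tail_const d m ?Q a (d - k) = 0"
      by (intro zero) auto
    \<comment> \<open>The constant at \<open>d - k\<close> is a factor of the one at
      \<open>1\<close>.\<close>
    then have "tail_const d m ?Q a 1 = 0"
      using k(1) by (intro tail_const_eq_0_mono[of 1 "d - k"]) auto
    then show ?thesis unfolding int by simp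
  qed
qed

end
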